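(* Let $(\mathfrak{L},\delta,R)$ be a $\lambda$-weighted Rota-Baxter LieDer pair and $(\mathcal{V},\delta_V,T)$ a representation of it. Then the map $\mathfrak{D}_{\mathrm{RBLieDer}}:\mathfrak{C}^n_{\mathrm{RBLieDer}}(L;\mathcal{V})\to\mathfrak{C}^{n+1}_{\mathrm{RBLieDer}}(L;\mathcal{V})$, $n\ge 1$, is a coboundary operator, i.e. $$\mathfrak{D}_{\mathrm{RBLieDer}}\circ\mathfrak{D}_{\mathrm{RBLieDer}}=0.$$
   Context: Fix a field $\mathbb{K}$ and $\lambda\in\mathbb{K}$. A $\lambda$-weighted Rota-Baxter LieDer pair $(\mathfrak{L},\delta,R)$ is a Lie algebra $\mathfrak{L}=(L,[\cdot,\cdot])$ over $\mathbb{K}$, a derivation $\delta$ of $\mathfrak{L}$, and a linear map $R:L\to L$ with $[Rx,Ry]=R([Rx,y]+[x,Ry]+\lambda[x,y])$ for all $x,y\in L$ and $R\circ\delta=\delta\circ R$. A representation of it is $(\mathcal{V},\delta_V,T)$, where $\mathcal{V}=(V,\rho)$, $V$ is a vector space, $\rho:L\to \mathrm{gl}(V)$ and $\delta_V,T:V\to V$ are linear, such that for all $x,y\in L$, $u\in V$: $\rho([x,y])=\rho(x)\rho(y)-\rho(y)\rho(x)$; $\delta_V\circ\rho(x)=\rho(\delta x)+\rho(x)\circ\delta_V$; $\rho(Rx)(Tu)=T(\rho(Rx)u+\rho(x)(Tu)+\lambda\rho(x)u)$; $T\circ\delta_V=\delta_V\circ T$. Put $[x,y]_R=[Rx,y]+[x,Ry]+\lambda[x,y]$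 (a Lie bracket on $L$; write $L_R$ for the resulting Lie algebra) and $\widetilde\rho(x)(a)=\rho(Rx)(a)-T(\rho(x)(a))$ (a representation of $L_R$ on $V$; write $\widetilde{\mathcal V}=(V,\widetilde\rho)$). Let $C^n(L;\mathcal{V})=C^n(L_R;\widetilde{\mathcal V})=\mathrm{Hom}(\wedge^nL,V)$ as vector spaces. Define: - $\mathrm{d}:C^n(L;\mathcal V)\to C^{n+1}(L;\mathcal V)$ by $(\mathrm{d}f)(x_1,\dots,x_{n+1})=\sum_{i=1}^{n+1}(-1)^{i+n}\rho(x_i)f(x_1,\dots,\hat{x_i},\dots,x_{n+1})+\sum_{1\le i<j\le n+1}(-1)^{i+j+n+1}f([x_i,x_j],x_1,\dots,\hat{x_i},\dots,\hat{x_j},\dots,x_{n+1})$; - $\mathrm{d}_R:C^n(L_R;\widetilde{\mathcal V})\to C^{n+1}(L_R;\widetilde{\mathcal V})$ by the same formula with $\rho$ and $[\cdot,\cdot]$ replaced by $\widetilde\rho$ and $[\cdot,\cdot]_R$; - $\partial:C^n(L;\mathcal V)\to C^n(L;\mathcal V)$, $n\geq 1$, by $\partial f=\sum_{i=1}^nf\circ(\mathbf 1\otimes\cdots\otimes\delta\otimes\cdots\otimes\mathbf 1)-\delta_V\circ f$ ($\delta$ in the $i$-th place); - $\Phi:C^n(L;\mathcal V)\to C^n(L_R;\widetilde{\mathcal V})$, $n\ge1$, by $\Phi(f)(x_1,\dots,x_n)=f(Rx_1,\dots,Rx_n)-\sum_{k=0}^{n-1}\lambda^{n-k-1}\sum_{i_1<\cdots<i_k}T\big(f(x_1,\dots,R(x_{i_1}),\dots,R(x_{i_k}),\dots,x_n)\big)$,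 where in the inner summand $R$ is applied exactly to the arguments in positions $i_1,\dots,i_k$. The cochain spaces are $\mathfrak{C}^0_{\mathrm{RBLieDer}}(L;\mathcal V)=0$, $\mathfrak{C}^1_{\mathrm{RBLieDer}}(L;\mathcal V)=\mathrm{Hom}(L,V)$, and for $n\ge2$, $\mathfrak{C}^n_{\mathrm{RBLieDer}}(L;\mathcal V)=\big(C^n(L;\mathcal V)\oplus C^{n-1}(L;\mathcal V)\big)\oplus C^{n-1}(L_R;\widetilde{\mathcal V})$. The map $\mathfrak{D}_{\mathrm{RBLieDer}}$ is given by $\mathfrak{D}_{\mathrm{RBLieDer}}(f)=(\mathrm{d}f,-\partial f,-\Phi f)$ for $n=1$, and $\mathfrak{D}_{\mathrm{RBLieDer}}((f,g),h)=(\mathrm{d}f,\ \mathrm{d}g+(-1)^n\partial f,\ -\mathrm{d}_Rh-\Phi f)$ for $n\ge2$. *)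

theory Defs
  imports Complex_Main "HOL-Library.Function_Algebras" "HOL-Library.Product_Plus"
begin

locale lie_algebra = vector_space scale
  for scale :: "'k::field \<Rightarrow> 'l::ab_group_add \<Rightarrow> 'l" +
  fixes br :: "'l \<Rightarrow> 'l \<Rightarrow> 'l"
  assumes br_linear_right: "Vector_Spaces.linear scale scale (\<lambda>y. br x y)"
    and br_linear_left: "Vector_Spaces.linear scale scale (\<lambda>x. br x y)"
    and br_alternating: "br x x = 0"
    and br_jacobi: "br x (br y z) + br y (br z x) + br z (br x y) = 0"

locale rota_baxter_lieder_pair = lie_algebra scale br
  for scale :: "'k::field \<Rightarrow> 'l::ab_group_add \<Rightarrow> 'l"
    and br :: "'l \<Rightarrow> 'l \<Rightarrow> 'l" +
  fixes lam :: 'k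
    and \<delta> :: "'l \<Rightarrow> 'l"
    and R :: "'l \<Rightarrow> 'l"
  assumes der_linear: "Vector_Spaces.linear scale scale \<delta>"
    and der_leibniz: "\<delta> (br x y) = br (\<delta> x) y + br x (\<delta> y)"
    and R_linear: "Vector_Spaces.linear scale scale R"
    and R_rota_baxter: "br (R x) (R y) = R (br (R x) y + br x (R y) + scale lam (br x y))"
    and R_der_commute: "R \<circ> \<delta> = \<delta> \<circ> R"

locale rota_baxter_lieder_representation =
  rota_baxter_lieder_pair scaleL br lam \<delta> R + V: vector_space scaleV
  for scaleL :: "'k::field \<Rightarrow> 'l::ab_group_add \<Rightarrow> 'l"
    and scaleV :: "'k \<Rightarrow> 'v::ab_group_add \<Rightarrow> 'v"
    and br :: "'l \<Rightarrow> 'l \<Rightarrow> 'l"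
    and lam :: 'k
    and \<delta> :: "'l \<Rightarrow> 'l"
    and R :: "'l \<Rightarrow> 'l" +
  fixes \<rho> :: "'l \<Rightarrow> 'v \<Rightarrow> 'v"
    and \<delta>V :: "'v \<Rightarrow> 'v"
    and T :: "'v \<Rightarrow> 'v"
  assumes rho_endomorphism: "Vector_Spaces.linear scaleV scaleV (\<rho> x)"
    and rho_linear: "Vector_Spaces.linear scaleL scaleV (\<lambda>x. \<rho> x u)"
    and derV_linear: "Vector_Spaces.linear scaleV scaleV \<delta>V"
    and T_linear: "Vector_Spaces.linear scaleV scaleV T"
    and rho_bracket: "\<rho> (br x y) u = \<rho> x (\<rho> y u) - \<rho> y (\<rho> x u)"
    and derV_rho: "\<delta>V (\<rho> x u) = \<rho> (\<delta> x) u + \<rho> x (\<delta>V u)"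
    and T_rota_baxter:
      "\<rho> (R x) (T u) = T (\<rho> (R x) u + \<rho> x (T u) + scaleV lam (\<rho> x u))"
    and T_derV_commute: "T \<circ> \<delta>V = \<delta>V \<circ> T"

definition bracket_R ::
    "('k::field \<Rightarrow> 'l::ab_group_add \<Rightarrow> 'l) \<Rightarrow> ('l \<Rightarrow> 'l \<Rightarrow> 'l) \<Rightarrow> 'k \<Rightarrow> ('l \<Rightarrow> 'l) \<Rightarrow> 'l \<Rightarrow> 'l \<Rightarrow> 'l" where
  "bracket_R scaleL br lam R x y = br (R x) y + br x (R y) + scaleL lam (br x y)"

definition rho_tilde ::
    "('l \<Rightarrow> 'l) \<Rightarrow> ('l \<Rightarrow> 'v::ab_group_add \<Rightarrow> 'v) \<Rightarrow> ('v \<Rightarrow> 'v) \<Rightarrow> 'l \<Rightarrow> 'v \<Rightarrow> 'v" where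
  "rho_tilde R \<rho> T x a = \<rho> (R x) a - T (\<rho> x a)"

text \<open>
  An element of $\mathrm{Hom}(\wedge^n L, V)$ is an alternating multilinear map on argument lists
  of length \<open>n\<close>. Its value on lists of any other length is fixed to be \<open>0\<close>, so that equality of
  cochains is equality of functions. ``Alternating'' means vanishing on repeated arguments, which
  is the right notion in every characteristic, including 2.
\<close>

type_synonym ('l, 'v) cochain = "'l list \<Rightarrow> 'v"

definition cochains ::
    "('k::field \<Rightarrow> 'l::ab_group_add \<Rightarrow> 'l) \<Rightarrow> ('k \<Rightarrow> 'v::ab_group_add \<Rightarrow> 'v) \<Rightarrow> nat
      \<Rightarrow> ('l, 'v) cochain set" where
  "cochains scaleL scaleV n = {f.
     (\<forall>xs. length xs \<noteq> n \<longrightarrow> f xs = 0) \<and>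
     (\<forall>xs i. length xs = n \<longrightarrow> i < n \<longrightarrow>
        Vector_Spaces.linear scaleL scaleV (\<lambda>x. f (xs[i := x]))) \<and>
     (\<forall>xs i j. length xs = n \<longrightarrow> i < j \<longrightarrow> j < n \<longrightarrow> xs ! i = xs ! j \<longrightarrow> f xs = 0)}"

text \<open>
  List positions count from 0, while the usual formulas number the arguments from 1. Replacing
  \<open>i\<close> by \<open>i + 1\<close> and \<open>j\<close> by \<open>j + 1\<close> turns the signs $(-1)^{i+n}$ and $(-1)^{i+j+n+1}$ into the
  ones below (the latter is unchanged). The list \<open>nths xs (- A)\<close> is \<open>xs\<close> with the positions in
  \<open>A\<close> omitted. In the following operators \<open>n\<close> is the degree of the argument \<open>f\<close>.
\<close>

definition ce_diff ::
    "('k::field \<Rightarrow> 'v::ab_group_add \<Rightarrow> 'v) \<Rightarrow> ('l \<Rightarrow> 'l \<Rightarrow> 'l) \<Rightarrow> ('l \<Rightarrow> 'v \<Rightarrow> 'v) \<Rightarrow> nat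
      \<Rightarrow> ('l, 'v) cochain \<Rightarrow> ('l, 'v) cochain" where
  "ce_diff scaleV br \<rho> n f = (\<lambda>xs. if length xs = n + 1
     then (\<Sum>i<n + 1. scaleV ((-1) ^ (i + 1 + n)) (\<rho> (xs ! i) (f (nths xs (- {i})))))
        + (\<Sum>j<n + 1. \<Sum>i<j. scaleV ((-1) ^ (i + j + n + 1))
             (f (br (xs ! i) (xs ! j) # nths xs (- {i, j}))))
     else 0)"

definition der_diff ::
    "('l \<Rightarrow> 'l) \<Rightarrow> ('v::ab_group_add \<Rightarrow> 'v) \<Rightarrow> nat \<Rightarrow> ('l, 'v) cochain \<Rightarrow> ('l, 'v) cochain" where
  "der_diff \<delta> \<delta>V n f = (\<lambda>xs. if length xs = n
     then (\<Sum>i<n. f (xs[i := \<delta> (xs ! i)])) - \<delta>V (f xs)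
     else 0)"

definition apply_at :: "('l \<Rightarrow> 'l) \<Rightarrow> nat set \<Rightarrow> 'l list \<Rightarrow> 'l list" where
  "apply_at R S xs = map (\<lambda>i. if i \<in> S then R (xs ! i) else xs ! i) [0..<length xs]"

text \<open>The set \<open>S\<close> below plays the role of the index tuple $i_1 < \dots < i_k$.\<close>

definition Phi ::
    "('k::field \<Rightarrow> 'v::ab_group_add \<Rightarrow> 'v) \<Rightarrow> 'k \<Rightarrow> ('l \<Rightarrow> 'l) \<Rightarrow> ('v \<Rightarrow> 'v) \<Rightarrow> nat
      \<Rightarrow> ('l, 'v) cochain \<Rightarrow> ('l, 'v) cochain" where
  "Phi scaleV lam R T n f = (\<lambda>xs. if length xs = n
     then f (map R xs)
        - (\<Sum>k<n. scaleV (lam ^ (n - k - 1))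
             (\<Sum>S | S \<subseteq> {..<n} \<and> card S = k. T (f (apply_at R S xs))))
     else 0)"

text \<open>
  The direct sums are sets of nested pairs \<open>((f, g), h)\<close>. In degree 1 the space is
  $\mathrm{Hom}(L, V)$ alone, embedded with zero second and third summand, so that all degrees
  share one type.
\<close>

type_synonym ('l, 'v) rb_cochain = "(('l, 'v) cochain \<times> ('l, 'v) cochain) \<times> ('l, 'v) cochain"

definition rb_cochains ::
    "('k::field \<Rightarrow> 'l::ab_group_add \<Rightarrow> 'l) \<Rightarrow> ('k \<Rightarrow> 'v::ab_group_add \<Rightarrow> 'v) \<Rightarrow> nat
      \<Rightarrow> ('l, 'v) rb_cochain set" where
  "rb_cochains scaleL scaleV n =
     (if n = 0 then {0}
      else if n = 1 then (cochains scaleL scaleV 1 \<times> {0}) \<times> {0}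
      else (cochains scaleL scaleV n \<times> cochains scaleL scaleV (n - 1))
             \<times> cochains scaleL scaleV (n - 1))"

definition scale_cochain ::
    "('k \<Rightarrow> 'v \<Rightarrow> 'v) \<Rightarrow> 'k \<Rightarrow> ('l, 'v) cochain \<Rightarrow> ('l, 'v) cochain" where
  "scale_cochain scaleV a f = (\<lambda>xs. scaleV a (f xs))"

fun scale_rb_cochain ::
    "('k \<Rightarrow> 'v \<Rightarrow> 'v) \<Rightarrow> 'k \<Rightarrow> ('l, 'v) rb_cochain \<Rightarrow> ('l, 'v) rb_cochain" where
  "scale_rb_cochain scaleV a ((f, g), h) =
     ((scale_cochain scaleV a f, scale_cochain scaleV a g), scale_cochain scaleV a h)"

text \<open>Only degrees \<open>n \<ge> 1\<close> are meaningful here.\<close>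

fun rb_diff ::
    "('k::field \<Rightarrow> 'l::ab_group_add \<Rightarrow> 'l) \<Rightarrow> ('k \<Rightarrow> 'v::ab_group_add \<Rightarrow> 'v) \<Rightarrow> ('l \<Rightarrow> 'l \<Rightarrow> 'l)
      \<Rightarrow> 'k \<Rightarrow> ('l \<Rightarrow> 'l) \<Rightarrow> ('l \<Rightarrow> 'l) \<Rightarrow> ('l \<Rightarrow> 'v \<Rightarrow> 'v) \<Rightarrow> ('v \<Rightarrow> 'v) \<Rightarrow> ('v \<Rightarrow> 'v) \<Rightarrow> nat
      \<Rightarrow> ('l, 'v) rb_cochain \<Rightarrow> ('l, 'v) rb_cochain" where
  "rb_diff scaleL scaleV br lam \<delta> R \<rho> \<delta>V T n ((f, g), h) =
     (let d = ce_diff scaleV br \<rho>;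
          dR = ce_diff scaleV (bracket_R scaleL br lam R) (rho_tilde R \<rho> T);
          D = der_diff \<delta> \<delta>V;
          P = Phi scaleV lam R T
      in if n = 1 then ((d n f, - D n f), - P n f)
         else ((d n f, d (n - 1) g + scale_cochain scaleV ((-1) ^ n) (D n f)),
               - dR (n - 1) h - P n f))"

end

theory Submission
  imports Defs
begin

text \<open>
  Everything reduces to \<open>d \<circ> d = 0\<close> (for \<open>L\<close> and for \<open>L\<^sub>R\<close>), \<open>d \<circ> \<partial> = \<partial> \<circ> d\<close> and
  \<open>d\<^sub>R \<circ> \<Phi> = \<Phi> \<circ> d\<close>. Up to sign, \<open>d\<close> is characterised by Cartan's formula
  \<open>\<iota>\<^sub>x \<circ> d = L\<^sub>x - d \<circ> \<iota>\<^sub>x\<close>, where \<open>\<iota>\<^sub>x\<close> inserts \<open>x\<close> as first argument and \<open>L\<^sub>x\<close> is the Lie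
  derivative; hence each identity follows by induction on the number of arguments from the
  corresponding statement about \<open>L\<^sub>x\<close>. For \<open>\<Phi>\<close> put \<open>Q = R + \<lambda>\<close>. Both \<open>R\<close> and \<open>Q\<close> are
  homomorphisms from \<open>L\<^sub>R\<close> to \<open>L\<close>, and \<open>\<Phi> f = f \<circ> R - T \<circ> P f\<close>, where \<open>P f\<close> is the sum over \<open>i\<close>
  of \<open>f (R x\<^sub>1, \<dots>, R x\<^sub>i\<^sub>-\<^sub>1, x\<^sub>i, Q x\<^sub>i\<^sub>+\<^sub>1, \<dots>, Q x\<^sub>n)\<close>, so that \<open>f \<circ> Q - f \<circ> R = \<lambda> P f\<close>.
  Then \<open>\<iota>\<^sub>x (\<Phi> f) = \<Phi> (\<iota>\<^sub>R\<^sub>x f) - T \<circ> (\<iota>\<^sub>x f) \<circ> Q\<close>, and \<open>T\<close> intertwines the action through \<open>Q\<close>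
  with the twisted one.
\<close>

section \<open>Multilinear and alternating functions on lists\<close>

text \<open>The list may be split anywhere and no degree is mentioned, so fixing the first argument
  stays inside the predicate. The inductions on the argument list rest on this; the degree is kept
  apart in \<open>supported\<close>.\<close>

definition multilinear ::
    "('k \<Rightarrow> 'l::ab_group_add \<Rightarrow> 'l) \<Rightarrow> ('k \<Rightarrow> 'v::ab_group_add \<Rightarrow> 'v) \<Rightarrow> ('l, 'v) cochain \<Rightarrow> bool" where
  "multilinear s1 s2 f \<longleftrightarrow>
     (\<forall>us vs x y. f (us @ (x + y) # vs) = f (us @ x # vs) + f (us @ y # vs)) \<and>
     (\<forall>us vs c x. f (us @ s1 c x # vs) = s2 c (f (us @ x # vs)))"

text \<open>Equal neighbours are easier to follow through a recursion than equal entries at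
  arbitrary positions; for multilinear maps \<open>alternating_distant\<close> recovers the general
  case.\<close>

definition alternating :: "('l, 'v::zero) cochain \<Rightarrow> bool" where
  "alternating f \<longleftrightarrow> (\<forall>us a vs. f (us @ a # a # vs) = 0)"

definition supported :: "nat \<Rightarrow> ('l, 'v::zero) cochain \<Rightarrow> bool" where
  "supported n f \<longleftrightarrow> (\<forall>xs. length xs \<noteq> n \<longrightarrow> f xs = 0)"

lemma multilinearI:
  assumes "\<And>us vs x y. f (us @ (x + y) # vs) = f (us @ x # vs) + f (us @ y # vs)"
    and "\<And>us vs c x. f (us @ s1 c x # vs) = s2 c (f (us @ x # vs))"
  shows "multilinear s1 s2 f"
  using assms by (simp add: multilinear_def)

lemma multilinear_add:
  "multilinear s1 s2 f \<Longrightarrow> f (us @ (x + y) # vs) = f (us @ x # vs) + f (us @ y # vs)"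
  by (simp add: multilinear_def)

lemma multilinear_scale:
  "multilinear s1 s2 f \<Longrightarrow> f (us @ s1 c x # vs) = s2 c (f (us @ x # vs))"
  by (simp add: multilinear_def)

lemma multilinear_add_Cons:
  "multilinear s1 s2 f \<Longrightarrow> f ((x + y) # vs) = f (x # vs) + f (y # vs)"
  using multilinear_add[of s1 s2 f "[]"] by simp

lemma multilinear_scale_Cons:
  "multilinear s1 s2 f \<Longrightarrow> f (s1 c x # vs) = s2 c (f (x # vs))"
  using multilinear_scale[of s1 s2 f "[]"] by simp

lemma multilinear_zero:
  assumes "multilinear s1 s2 f"
  shows "f (us @ 0 # vs) = 0"
  using multilinear_add[OF assms, of us 0 0 vs] by simp

lemma multilinear_zero_Cons: "multilinear s1 s2 f \<Longrightarrow> f (0 # vs) = 0"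
  using multilinear_zero[of s1 s2 f "[]"] by simp

lemma multilinear_minus_Cons:
  assumes "multilinear s1 s2 f"
  shows "f ((- x) # vs) = - f (x # vs)"
  using multilinear_add_Cons[OF assms, of x "- x" vs] multilinear_zero_Cons[OF assms]
  by (simp add: eq_neg_iff_add_eq_0 add.commute)

lemma multilinear_diff_Cons:
  "multilinear s1 s2 f \<Longrightarrow> f ((x - y) # vs) = f (x # vs) - f (y # vs)"
  using multilinear_add_Cons[of s1 s2 f x "- y" vs] by (simp add: multilinear_minus_Cons)

lemma multilinear_partial: "multilinear s1 s2 f \<Longrightarrow> multilinear s1 s2 (\<lambda>ys. f (x # ys))"
  unfolding multilinear_def by (metis append_Cons)

lemma multilinear_map:
  assumes "multilinear s1 s2 f" "Vector_Spaces.linear s1 s1 h"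
  shows "multilinear s1 s2 (\<lambda>ys. f (map h ys))"
  using assms by (auto simp: multilinear_def Vector_Spaces.linear_iff)

lemma multilinear_compose:
  assumes "multilinear s1 s2 f" "Vector_Spaces.linear s2 s2 t"
  shows "multilinear s1 s2 (\<lambda>ys. t (f ys))"
  using assms by (auto simp: multilinear_def Vector_Spaces.linear_iff)

lemma multilinear_diff:
  assumes "vector_space s2" "multilinear s1 s2 f" "multilinear s1 s2 g"
  shows "multilinear s1 s2 (\<lambda>ys. f ys - g ys)"
  using assms by (auto simp: multilinear_def module.scale_right_diff_distrib vector_space_def module_def)

lemma multilinear_plus:
  assumes "vector_space s2" "multilinear s1 s2 f" "multilinear s1 s2 g"
  shows "multilinear s1 s2 (\<lambda>ys. f ys + g ys)"
  using assms by (auto simp: multilinear_def module.scale_right_distrib vector_space_def module_def)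

lemma alternatingD: "alternating f \<Longrightarrow> f (us @ a # a # vs) = 0"
  by (simp add: alternating_def)

lemma alternating_partial: "alternating f \<Longrightarrow> alternating (\<lambda>ys. f (x # ys))"
  unfolding alternating_def by (metis append_Cons)

lemma supported_partial: "supported (Suc n) f \<Longrightarrow> supported n (\<lambda>ys. f (x # ys))"
  by (simp add: supported_def)

text \<open>Polarisation: with \<open>a + b\<close> in both slots the two diagonal terms vanish, in
  every characteristic.\<close>

lemma alternating_swap:
  assumes f: "multilinear s1 s2 f" "alternating f"
  shows "f (us @ a # b # vs) = - f (us @ b # a # vs)"
proof -
  have "0 = f (us @ (a + b) # (a + b) # vs)"
    using alternatingD[OF f(2)] by simp
  also have "\<dots> = f (us @ a # (a + b) # vs) + f (us @ b # (a + b) # vs)"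
    by (rule multilinear_add[OF f(1)])
  also have "\<dots> = f (us @ a # b # vs) + f (us @ b # a # vs)"
    using multilinear_add[OF f(1), of "us @ [a]" a b vs]
      multilinear_add[OF f(1), of "us @ [b]" a b vs] alternatingD[OF f(2)]
    by simp
  finally show ?thesis
    by (simp add: eq_neg_iff_add_eq_0)
qed

lemma alternating_swap_Cons:
  "multilinear s1 s2 f \<Longrightarrow> alternating f \<Longrightarrow> f (a # b # vs) = - f (b # a # vs)"
  using alternating_swap[of s1 s2 f "[]" a b vs] by simp

text \<open>Swaps, each costing only a sign, carry the left copy of \<open>a\<close> through
  \<open>ws\<close> until it meets the right one.\<close>

lemma alternating_distant:
  assumes f: "multilinear s1 s2 f" "alternating f"
  shows "f (us @ a # ws @ a # vs) = 0"
proof (induction ws arbitrary: us)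
  case Nil
  then show ?case using f(2) by (simp add: alternatingD)
next
  case (Cons w ws)
  then show ?case
    using alternating_swap[OF f, of us a w "ws @ a # vs"] Cons[of "us @ [w]"] by simp
qed

lemma cochains_iff:
  assumes vs: "vector_space s1" "vector_space s2"
  shows "f \<in> cochains s1 s2 n \<longleftrightarrow> supported n f \<and> multilinear s1 s2 f \<and> alternating f"
proof (intro iffI conjI)
  assume f: "f \<in> cochains s1 s2 n"
  then show "supported n f"
    by (simp add: cochains_def supported_def)
  have lin: "Vector_Spaces.linear s1 s2 (\<lambda>x. f (us @ x # ws))" for us ws
  proof (cases "length us + Suc (length ws) = n")
    case True
    \<comment> \<open>The defining condition speaks of list updates, so the slot is filled with
      \<open>undefined\<close>, which the update overwrites.\<close>
    have "Vector_Spaces.linear s1 s2 (\<lambda>x. f ((us @ undefined # ws)[length us := x]))"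
      using f True by (auto simp: cochains_def simp del: list_update_length)
    then show ?thesis by simp
  next
    case False
    then have "(\<lambda>x. f (us @ x # ws)) = (\<lambda>x. 0)"
      using f by (auto simp: cochains_def)
    then show ?thesis
      using vs by (simp add: Vector_Spaces.linear_iff vector_space_def module.scale_zero_right module_def)
  qed
  then show "multilinear s1 s2 f"
    by (simp add: multilinear_def Vector_Spaces.linear_iff)
  show "alternating f"
    unfolding alternating_def
  proof (intro allI)
    fix us ws a
    show "f (us @ a # a # ws) = 0"
    proof (cases "length us + Suc (Suc (length ws)) = n")
      case True
      have "(us @ a # a # ws) ! length us = (us @ a # a # ws) ! Suc (length us)"
        by (simp add: nth_append)
      then show ?thesis
        using f True unfolding cochains_def mem_Collect_eq
        by (metis add_Suc_right length_Cons length_append less_add_Suc1 lessI add_Suc)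
    next
      case False
      then show ?thesis using f by (simp add: cochains_def)
    qed
  qed
next
  assume f: "supported n f \<and> multilinear s1 s2 f \<and> alternating f"
  have "f xs = 0" if "length xs = n" "i < j" "j < n" "xs ! i = xs ! j" for xs i j
  proof -
    have "xs = take i xs @ xs ! i # drop (Suc i) xs"
      using that by (intro id_take_nth_drop) simp
    moreover have "drop (Suc i) xs
        = take (j - Suc i) (drop (Suc i) xs) @ xs ! j # drop (Suc j) xs"
      using that id_take_nth_drop[of "j - Suc i" "drop (Suc i) xs"] by simp
    ultimately have "xs = take i xs @ xs ! i # take (j - Suc i) (drop (Suc i) xs)
        @ xs ! i # drop (Suc j) xs"
      using that by simp
    then show ?thesis
      using alternating_distant[of s1 s2 f] f by metis
  qed
  moreover have "Vector_Spaces.linear s1 s2 (\<lambda>x. f (xs[i := x]))" if "length xs = n" "i < n" for xs i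
    using that vs f by (simp add: Vector_Spaces.linear_iff upd_conv_take_nth_drop multilinear_def)
  ultimately show "f \<in> cochains s1 s2 n"
    using f by (simp add: cochains_def supported_def)
qed

text \<open>Bringing slot \<open>j\<close> to the front costs \<open>j\<close> transpositions. The
  explicit differential puts a bracket first, whereas the Lie derivative leaves it in its
  slot.\<close>

lemma alternating_move_front:
  assumes "multilinear s1 s2 f" "alternating f" "vector_space s2" "j < length xs"
  shows "f (b # nths xs (- {j})) = s2 ((-1) ^ j) (f (xs[j := b]))"
  using assms
proof (induction xs arbitrary: f j)
  case Nil
  then show ?case by simp
next
  case (Cons x xs)
  interpret V: vector_space s2 by fact
  show ?case
  proof (cases j)
    case 0
    have "nths xs {j. Suc j \<noteq> 0} = xs" by (simp add: nths_all)
    then show ?thesis using 0 by (simp add: nths_Cons)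
  next
    case (Suc i)
    have "{k. Suc k \<in> - {Suc i}} = - {i}" by auto
    then have "f (b # nths (x # xs) (- {j})) = f (b # x # nths xs (- {i}))"
      using Suc by (simp add: nths_Cons)
    also have "\<dots> = - f (x # b # nths xs (- {i}))"
      using Cons.prems by (intro alternating_swap_Cons)
    also have "\<dots> = - s2 ((-1) ^ i) (f (x # xs[i := b]))"
      using Cons.IH[OF multilinear_partial[OF Cons.prems(1), of x]
          alternating_partial[OF Cons.prems(2)], of i] Cons.prems(3,4) Suc
      by simp
    finally show ?thesis using Suc by simp
  qed
qed

section \<open>Operators defined by recursion on the first argument\<close>

text \<open>With the derivation as \<open>\<phi>\<close> this is the argument part of \<partial>;
  with \<open>br x\<close> it is the bracket part of the Lie derivative. Both share the calculus
  below.\<close>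

fun slot_sum :: "('l \<Rightarrow> 'l) \<Rightarrow> ('l, 'v::ab_group_add) cochain \<Rightarrow> ('l, 'v) cochain" where
  "slot_sum \<phi> f [] = 0"
| "slot_sum \<phi> f (x # xs) = f (\<phi> x # xs) + slot_sum \<phi> (\<lambda>ys. f (x # ys)) xs"

definition lie_deriv ::
    "('l \<Rightarrow> 'l \<Rightarrow> 'l) \<Rightarrow> ('l \<Rightarrow> 'v \<Rightarrow> 'v) \<Rightarrow> 'l \<Rightarrow> ('l, 'v::ab_group_add) cochain \<Rightarrow> ('l, 'v) cochain" where
  "lie_deriv br \<rho> x f ys = \<rho> x (f ys) - slot_sum (br x) f ys"

text \<open>Cartan's formula \<open>\<iota>\<^sub>x \<circ> d = L\<^sub>x - d \<circ> \<iota>\<^sub>x\<close> read as a recursion.\<close>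

fun cartan ::
    "('l \<Rightarrow> 'l \<Rightarrow> 'l) \<Rightarrow> ('l \<Rightarrow> 'v \<Rightarrow> 'v) \<Rightarrow> ('l, 'v::ab_group_add) cochain \<Rightarrow> ('l, 'v) cochain" where
  "cartan br \<rho> f [] = 0"
| "cartan br \<rho> f (x # xs) = lie_deriv br \<rho> x f xs - cartan br \<rho> (\<lambda>ys. f (x # ys)) xs"

lemma slot_sum_eq_sum: "slot_sum \<phi> f xs = (\<Sum>i<length xs. f (xs[i := \<phi> (xs ! i)]))"
  by (induction xs arbitrary: f) (simp_all add: sum.lessThan_Suc_shift del: sum.lessThan_Suc)

lemma slot_sum_add: "slot_sum \<phi> (\<lambda>ys. f ys + g ys) xs = slot_sum \<phi> f xs + slot_sum \<phi> g xs"
  by (simp add: slot_sum_eq_sum sum.distrib)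

lemma slot_sum_diff: "slot_sum \<phi> (\<lambda>ys. f ys - g ys) xs = slot_sum \<phi> f xs - slot_sum \<phi> g xs"
  by (simp add: slot_sum_eq_sum sum_subtractf)

lemma slot_sum_compose:
  assumes "additive t"
  shows "slot_sum \<phi> (\<lambda>ys. t (f ys)) xs = t (slot_sum \<phi> f xs)"
  by (simp add: slot_sum_eq_sum additive.sum[OF assms])

lemma slot_sum_map:
  assumes "\<And>y. h (\<phi> y) = \<chi> (h y)"
  shows "slot_sum \<phi> (\<lambda>ys. f (map h ys)) xs = slot_sum \<chi> f (map h xs)"
  by (induction xs arbitrary: f) (simp_all add: assms)

lemma slot_sum_zero: "slot_sum \<phi> (\<lambda>ys. 0) xs = 0"
  by (simp add: slot_sum_eq_sum)

lemma slot_sum_supported: "supported n f \<Longrightarrow> supported n (slot_sum \<phi> f)"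
  by (simp add: supported_def slot_sum_eq_sum)

text \<open>Terms in which the two maps hit different slots occur in both orders and cancel; those
  hitting one slot twice survive. The outer operator changes the arguments first, hence the reversed
  composition.\<close>

lemma slot_sum_commutator:
  "slot_sum \<phi> (slot_sum \<psi> f) xs - slot_sum \<psi> (slot_sum \<phi> f) xs
     = slot_sum (\<lambda>y. \<psi> (\<phi> y)) f xs - slot_sum (\<lambda>y. \<phi> (\<psi> y)) f xs"
proof (induction xs arbitrary: f)
  case (Cons x xs)
  show ?case
    using Cons[of "\<lambda>ys. f (x # ys)"] by (simp add: slot_sum_add algebra_simps)
qed simp

lemma slot_sum_arg_add:
  assumes "multilinear s1 s2 f"
  shows "slot_sum (\<lambda>y. \<phi> y + \<psi> y) f xs = slot_sum \<phi> f xs + slot_sum \<psi> f xs"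
  using assms
  by (induction xs arbitrary: f)
    (simp_all add: multilinear_add_Cons multilinear_partial algebra_simps)

lemma slot_sum_arg_diff:
  assumes "multilinear s1 s2 f"
  shows "slot_sum (\<lambda>y. \<phi> y - \<psi> y) f xs = slot_sum \<phi> f xs - slot_sum \<psi> f xs"
  using assms
  by (induction xs arbitrary: f)
    (simp_all add: multilinear_diff_Cons multilinear_partial algebra_simps)

lemma slot_sum_arg_scale:
  assumes "multilinear s1 s2 f" "vector_space s2"
  shows "slot_sum (\<lambda>y. s1 c (\<phi> y)) f xs = s2 c (slot_sum \<phi> f xs)"
proof -
  interpret V: vector_space s2 by fact
  show ?thesis
    using assms(1)
    by (induction xs arbitrary: f)
      (simp_all add: multilinear_scale_Cons multilinear_partial V.scale_right_distrib)
qed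

lemma additive_scale: "vector_space s \<Longrightarrow> additive (s c)"
  by (simp add: additive_def vector_space_def)

lemma linear_imp_additive: "Vector_Spaces.linear s1 s2 t \<Longrightarrow> additive t"
  by (simp add: additive_def Vector_Spaces.linear_iff)

lemma slot_sum_multilinear:
  assumes f: "multilinear s1 s2 f" and "vector_space s2" and \<phi>: "Vector_Spaces.linear s1 s1 \<phi>"
  shows "multilinear s1 s2 (slot_sum \<phi> f)"
proof (rule multilinearI)
  interpret V: vector_space s2 by fact
  note \<phi>' = \<phi>[unfolded Vector_Spaces.linear_iff]
  show "slot_sum \<phi> f (us @ (x + y) # vs) = slot_sum \<phi> f (us @ x # vs) + slot_sum \<phi> f (us @ y # vs)"
    for us vs x y
    using f
  proof (induction us arbitrary: f)
    case Nil
    then show ?case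
      by (simp add: \<phi>' multilinear_add_Cons slot_sum_add)
  next
    case (Cons u us)
    then show ?case
      using multilinear_add[OF Cons.prems, of "\<phi> u # us"]
      by (simp add: Cons.IH[OF multilinear_partial])
  qed
  show "slot_sum \<phi> f (us @ s1 c x # vs) = s2 c (slot_sum \<phi> f (us @ x # vs))" for us vs c x
    using f
  proof (induction us arbitrary: f)
    case Nil
    then show ?case
      by (simp add: \<phi>' multilinear_scale_Cons V.scale_right_distrib
          slot_sum_compose[OF additive_scale[OF V.vector_space_axioms]])
  next
    case (Cons u us)
    then show ?case
      using multilinear_scale[OF Cons.prems, of "\<phi> u # us"]
      by (simp add: Cons.IH[OF multilinear_partial] V.scale_right_distrib)
  qed
qed

text \<open>The terms that hit one of the two equal slots cancel by skew-symmetry; every other term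
  keeps two equal neighbours.\<close>

lemma slot_sum_alternating:
  assumes "multilinear s1 s2 f" "alternating f"
  shows "alternating (slot_sum \<phi> f)"
  unfolding alternating_def
proof (intro allI)
  fix us a vs
  show "slot_sum \<phi> f (us @ a # a # vs) = 0"
    using assms
  proof (induction us arbitrary: f)
    case Nil
    then have "(\<lambda>ys. f (a # a # ys)) = (\<lambda>ys. 0)"
      using alternatingD[of f "[]"] by auto
    then show ?case
      using alternating_swap_Cons[OF Nil, of "\<phi> a" a vs] by (simp add: slot_sum_zero)
  next
    case (Cons u us)
    then show ?case
      using alternatingD[of f "\<phi> u # us"]
      by (simp add: Cons.IH[OF multilinear_partial alternating_partial])
  qed
qed

text \<open>Pullback along a bracket-preserving \<open>h\<close> and pushforward along an
  intertwiner \<open>t\<close> pass through each step of Cartan's recursion. Later \<open>h\<close>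
  is \<open>Q\<close> and \<open>t\<close> is \<open>T\<close>.\<close>

lemma cartan_natural:
  assumes "additive t" and "\<And>x y. h (br' x y) = br (h x) (h y)"
    and "\<And>x u. \<rho>' x (t u) = t (\<rho> (h x) u)"
  shows "cartan br' \<rho>' (\<lambda>ys. t (f (map h ys))) xs = t (cartan br \<rho> f (map h xs))"
proof (induction xs arbitrary: f)
  case Nil
  then show ?case using additive.zero[OF assms(1)] by simp
next
  case (Cons x xs)
  have "slot_sum (br' x) (\<lambda>ys. t (f (map h ys))) xs = t (slot_sum (br (h x)) f (map h xs))"
    by (subst slot_sum_compose[OF assms(1)]) (simp add: slot_sum_map assms(2))
  then show ?case
    using Cons[of "\<lambda>ys. f (h x # ys)"]
    by (simp add: lie_deriv_def assms(3) additive.diff[OF assms(1)])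
qed

section \<open>The Chevalley--Eilenberg differential\<close>

text \<open>Kept free of Rota-Baxter data, so that the theory applies to L and once more to L_R with
  the twisted action.\<close>

locale lie_module = lie_algebra scaleL br + V: vector_space scaleV
  for scaleL :: "'k::field \<Rightarrow> 'l::ab_group_add \<Rightarrow> 'l"
    and scaleV :: "'k \<Rightarrow> 'v::ab_group_add \<Rightarrow> 'v"
    and br :: "'l \<Rightarrow> 'l \<Rightarrow> 'l" +
  fixes \<rho> :: "'l \<Rightarrow> 'v \<Rightarrow> 'v"
  assumes action_endo: "Vector_Spaces.linear scaleV scaleV (\<rho> x)"
    and action_linear: "Vector_Spaces.linear scaleL scaleV (\<lambda>x. \<rho> x u)"
    and action_bracket: "\<rho> (br x y) u = \<rho> x (\<rho> y u) - \<rho> y (\<rho> x u)"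
begin

lemma action_additive: "additive (\<rho> x)"
  by (rule linear_imp_additive[OF action_endo])

lemmas action_add = additive.add[OF action_additive]
  and action_diff = additive.diff[OF action_additive]
  and action_zero = additive.zero[OF action_additive]

lemma action_scale: "\<rho> x (scaleV c u) = scaleV c (\<rho> x u)"
  using action_endo by (simp add: Vector_Spaces.linear_iff)

lemma action_arg_add: "\<rho> (x + y) u = \<rho> x u + \<rho> y u"
  and action_arg_scale: "\<rho> (scaleL c x) u = scaleV c (\<rho> x u)"
  using action_linear by (simp_all add: Vector_Spaces.linear_iff)

lemma br_add_right: "br x (y + z) = br x y + br x z"
  and br_add_left: "br (x + y) z = br x z + br y z"
  and br_scale_right: "br x (scaleL c y) = scaleL c (br x y)"
  and br_scale_left: "br (scaleL c x) y = scaleL c (br x y)"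
  using br_linear_right br_linear_left by (simp_all add: Vector_Spaces.linear_iff)

lemma br_skew: "br x y = - br y x"
proof -
  have "br (x + y) (x + y) = 0" by (rule br_alternating)
  then show ?thesis
    by (simp add: br_add_left br_add_right br_alternating[of x] br_alternating[of y]
        eq_neg_iff_add_eq_0 add.commute)
qed

lemma br_minus_right: "br x (- y) = - br x y"
  using br_add_right[of x y "- y"] br_add_right[of x 0 0] by (simp add: eq_neg_iff_add_eq_0 add.commute)

lemma br_derivation: "br x (br y z) - br y (br x z) = br (br x y) z"
proof -
  have "br x (br y z) + br y (br z x) + br z (br x y) = 0" by (rule br_jacobi)
  moreover have "br y (br z x) = - br y (br x z)"
    by (metis br_skew br_minus_right)
  moreover have "br z (br x y) = - br (br x y) z" by (rule br_skew)
  ultimately show ?thesis by (simp add: algebra_simps)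
qed

abbreviation lie where "lie \<equiv> lie_deriv br \<rho>"
abbreviation dCE where "dCE \<equiv> cartan br \<rho>"

lemma lie_Cons: "lie x f (y # ys) = lie x (\<lambda>zs. f (y # zs)) ys - f (br x y # ys)"
  by (simp add: lie_deriv_def)

lemma lie_add: "lie x (\<lambda>ys. f ys + g ys) xs = lie x f xs + lie x g xs"
  by (simp add: lie_deriv_def action_add slot_sum_add)

lemma lie_diff: "lie x (\<lambda>ys. f ys - g ys) xs = lie x f xs - lie x g xs"
  by (simp add: lie_deriv_def action_diff slot_sum_diff)

lemma lie_scale: "lie x (\<lambda>ys. scaleV c (f ys)) xs = scaleV c (lie x f xs)"
  by (simp add: lie_deriv_def action_scale slot_sum_compose[OF additive_scale[OF V.vector_space_axioms]]
      V.scale_right_diff_distrib)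

lemma lie_arg_add: "multilinear scaleL scaleV f \<Longrightarrow> lie (x + y) f xs = lie x f xs + lie y f xs"
  using slot_sum_arg_add[of scaleL scaleV f "br x" "br y" xs]
  by (simp add: lie_deriv_def action_arg_add br_add_left[symmetric])

lemma lie_arg_scale:
  "multilinear scaleL scaleV f \<Longrightarrow> lie (scaleL c x) f xs = scaleV c (lie x f xs)"
  using slot_sum_arg_scale[of scaleL scaleV f c "br x" xs]
  by (simp add: lie_deriv_def action_arg_scale br_scale_left[symmetric]
      V.vector_space_axioms V.scale_right_diff_distrib)

lemma dCE_add: "dCE (\<lambda>ys. f ys + g ys) xs = dCE f xs + dCE g xs"
proof (induction xs arbitrary: f g)
  case (Cons x xs)
  show ?case
    by (simp only: cartan.simps lie_add Cons.IH[of "\<lambda>ys. f (x # ys)" "\<lambda>ys. g (x # ys)"])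
      (simp add: algebra_simps)
qed simp

lemma dCE_scale: "dCE (\<lambda>ys. scaleV c (f ys)) xs = scaleV c (dCE f xs)"
  by (induction xs arbitrary: f) (simp_all add: lie_scale V.scale_right_diff_distrib)

lemma dCE_diff: "dCE (\<lambda>ys. f ys - g ys) xs = dCE f xs - dCE g xs"
  by (induction xs arbitrary: f g) (simp_all add: lie_diff)

text \<open>The action part is \<open>action_bracket\<close>. In the bracket part the reversed order
  in \<open>slot_sum_commutator\<close> gives the minus sign that \<open>lie\<close> carries, and
  Jacobi does the rest.\<close>

lemma lie_bracket:
  assumes "multilinear scaleL scaleV f"
  shows "lie x (lie y f) xs - lie y (lie x f) xs = lie (br x y) f xs"
proof -
  have "lie x (lie y f) xs - lie y (lie x f) xs
      = \<rho> x (\<rho> y (f xs)) - \<rho> y (\<rho> x (f xs))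
        + (slot_sum (br x) (slot_sum (br y) f) xs - slot_sum (br y) (slot_sum (br x) f) xs)"
    by (simp add: lie_deriv_def[abs_def] slot_sum_diff slot_sum_compose[OF action_additive] action_diff)
  also have "slot_sum (br x) (slot_sum (br y) f) xs - slot_sum (br y) (slot_sum (br x) f) xs
      = - slot_sum (\<lambda>z. br x (br y z) - br y (br x z)) f xs"
    by (simp add: slot_sum_commutator slot_sum_arg_diff[OF assms])
  also have "\<rho> x (\<rho> y (f xs)) - \<rho> y (\<rho> x (f xs)) + - slot_sum (\<lambda>z. br x (br y z) - br y (br x z)) f xs
      = lie (br x y) f xs"
    by (simp add: br_derivation action_bracket lie_deriv_def)
  finally show ?thesis .
qed

text \<open>At a first argument \<open>y\<close> the terms with \<open>y\<close> inserted agree by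
  induction; what remains is the commutator of \<open>lie x\<close> and
  \<open>lie y\<close>.\<close>

lemma dCE_lie:
  assumes "multilinear scaleL scaleV f"
  shows "dCE (lie x f) xs = lie x (dCE f) xs"
  using assms
proof (induction xs arbitrary: f)
  case Nil
  then show ?case by (simp add: lie_deriv_def action_zero)
next
  case (Cons y ys)
  then show ?case
    using Cons.IH[OF multilinear_partial[OF Cons.prems, of y]] lie_bracket[OF Cons.prems, of x y ys]
    by (simp add: lie_Cons lie_diff dCE_diff algebra_simps)
qed

text \<open>Cartan's formula twice turns insertion of \<open>x\<close> after d d into (L_x d - d
  L_x) plus d d after insertion. The first vanishes by \<open>dCE_lie\<close>, the second by
  induction.\<close>

theorem dCE_squared:
  assumes "multilinear scaleL scaleV f"
  shows "dCE (dCE f) xs = 0"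
  using assms
proof (induction xs arbitrary: f)
  case (Cons x xs)
  then show ?case
    using Cons.IH[OF multilinear_partial[OF Cons.prems, of x]]
    by (simp add: dCE_diff dCE_lie)
qed simp

lemma lie_multilinear:
  assumes "multilinear scaleL scaleV f"
  shows "multilinear scaleL scaleV (lie x f)"
  unfolding lie_deriv_def[abs_def]
  by (intro multilinear_diff multilinear_compose[OF assms] slot_sum_multilinear[OF assms]
      V.vector_space_axioms action_endo br_linear_right)

lemma lie_alternating:
  assumes "multilinear scaleL scaleV f" "alternating f"
  shows "alternating (lie x f)"
  using assms slot_sum_alternating[OF assms, of "br x"]
  by (simp add: alternating_def lie_deriv_def action_zero)

lemma dCE_multilinear:
  assumes f: "multilinear scaleL scaleV f"
  shows "multilinear scaleL scaleV (dCE f)"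
proof (rule multilinearI)
  show "dCE f (us @ (x + y) # vs) = dCE f (us @ x # vs) + dCE f (us @ y # vs)" for us vs x y
    using f
  proof (induction us arbitrary: f)
    case Nil
    then show ?case
      by (simp add: lie_arg_add multilinear_add_Cons dCE_add)
  next
    case (Cons u us)
    then show ?case
      by (simp add: Cons.IH[OF multilinear_partial] multilinear_add[OF lie_multilinear])
  qed
  show "dCE f (us @ scaleL c x # vs) = scaleV c (dCE f (us @ x # vs))" for us vs c x
    using f
  proof (induction us arbitrary: f)
    case Nil
    then show ?case
      by (simp add: lie_arg_scale multilinear_scale_Cons dCE_scale V.scale_right_diff_distrib)
  next
    case (Cons u us)
    then show ?case
      by (simp add: Cons.IH[OF multilinear_partial] multilinear_scale[OF lie_multilinear]
          V.scale_right_diff_distrib)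
  qed
qed

lemma dCE_zero: "dCE (\<lambda>ys. 0) xs = 0"
  using dCE_diff[of "\<lambda>ys. 0" "\<lambda>ys. 0" xs] by simp

lemma dCE_alternating:
  assumes "multilinear scaleL scaleV f" "alternating f"
  shows "alternating (dCE f)"
  unfolding alternating_def
proof (intro allI)
  fix us a vs
  show "dCE f (us @ a # a # vs) = 0"
    using assms
  proof (induction us arbitrary: f)
    case Nil
    then have "(\<lambda>ys. f (a # a # ys)) = (\<lambda>ys. 0)"
      using alternatingD[of f "[]"] by auto
    \<comment> \<open>Cartan's formula twice leaves two opposite copies of a Lie derivative,
      \<open>f\<close> at \<open>br a a\<close>, and the differential of the zero map.\<close>
    then show ?case
      using Nil by (simp add: lie_Cons br_alternating multilinear_zero_Cons dCE_zero)
  next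
    case (Cons u us)
    then show ?case
      by (simp add: Cons.IH[OF multilinear_partial alternating_partial]
          alternatingD[OF lie_alternating])
  qed
qed

lemma dCE_supported:
  assumes "supported n f"
  shows "supported (Suc n) (dCE f)"
  unfolding supported_def
proof (intro allI impI)
  fix xs :: "'l list"
  assume "length xs \<noteq> Suc n"
  then show "dCE f xs = 0"
    using assms
  proof (induction xs arbitrary: f n)
    case (Cons x xs)
    have "lie x f xs = 0"
      using Cons.prems slot_sum_supported[OF Cons.prems(2), of "br x"]
      by (simp add: lie_deriv_def supported_def action_zero)
    moreover have "dCE (\<lambda>ys. f (x # ys)) xs = 0"
    proof (cases n)
      case 0
      \<comment> \<open>Degree 0 cannot be lowered: \<open>f\<close> lives on the empty list alone,
        so inserting \<open>x\<close> gives the zero map.\<close>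
      then have "(\<lambda>ys. f (x # ys)) = (\<lambda>ys. 0)"
        using Cons.prems(2) by (auto simp: supported_def)
      then show ?thesis by (simp add: dCE_zero)
    next
      case (Suc m)
      then show ?thesis
        using Cons.IH[OF _ supported_partial[of m f x]] Cons.prems by simp
    qed
    ultimately show ?case by simp
  qed simp
qed

text \<open>The terms in which position 0 is acted with or bracketed form the Lie derivative along
  \<open>x\<close>; the others form minus the differential after inserting \<open>x\<close>.\<close>

lemma dCE_eq_sum:
  assumes "multilinear scaleL scaleV f" "alternating f"
  shows "dCE f xs = (\<Sum>i<length xs. scaleV ((-1) ^ i) (\<rho> (xs ! i) (f (nths xs (- {i})))))
     + (\<Sum>j<length xs. \<Sum>i<j. scaleV ((-1) ^ (i + j))
          (f (br (xs ! i) (xs ! j) # nths xs (- {i, j}))))"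
  using assms
proof (induction xs arbitrary: f)
  case (Cons x xs)
  let ?n = "length xs"
  have shift: "nths (x # xs) (- {0}) = xs"
      "nths (x # xs) (- {Suc i}) = x # nths xs (- {i})"
      "nths (x # xs) (- {0, Suc i}) = nths xs (- {i})"
      "nths (x # xs) (- {Suc i, Suc j}) = x # nths xs (- {i, j})" for i j
  proof -
    have "{j. Suc j \<in> - {Suc i}} = - {i}" "{j. Suc j \<in> - {0, Suc i}} = - {i}"
        "{k. Suc k \<in> - {Suc i, Suc j}} = - {i, j}"
      by auto
    then show "nths (x # xs) (- {0}) = xs"
      "nths (x # xs) (- {Suc i}) = x # nths xs (- {i})"
      "nths (x # xs) (- {0, Suc i}) = nths xs (- {i})"
      "nths (x # xs) (- {Suc i, Suc j}) = x # nths xs (- {i, j})"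
      by (simp_all add: nths_Cons nths_all)
  qed
  \<comment> \<open>The pair (0, j + 1) has sign (-1)^(j + 1). Moving the bracket back to slot
    \<open>j\<close> absorbs (-1)^j, and the remaining minus is the one in
    \<open>lie_deriv\<close>.\<close>
  have front: "(\<Sum>j<?n. scaleV ((-1) ^ j) (f (br x (xs ! j) # nths xs (- {j}))))
      = slot_sum (br x) f xs"
    by (simp add: slot_sum_eq_sum alternating_move_front[OF Cons.prems V.vector_space_axioms]
        flip: power_mult_distrib)
  \<comment> \<open>The minus sign comes from swapping \<open>x\<close> with the bracket, which
    stands first in the explicit formula.\<close>
  have IH: "dCE (\<lambda>ys. f (x # ys)) xs
      = (\<Sum>i<?n. scaleV ((-1) ^ i) (\<rho> (xs ! i) (f (x # nths xs (- {i})))))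
        - (\<Sum>j<?n. \<Sum>i<j. scaleV ((-1) ^ (i + j))
          (f (br (xs ! i) (xs ! j) # x # nths xs (- {i, j}))))"
    using Cons.IH[OF multilinear_partial[OF Cons.prems(1), of x] alternating_partial[OF Cons.prems(2)]]
      alternating_swap_Cons[OF Cons.prems, of _ x]
    by (simp add: sum_negf)
  show ?case
    unfolding cartan.simps IH lie_deriv_def
    by (simp add: sum.lessThan_Suc_shift shift sum.distrib front sum_negf sum_subtractf
        del: sum.lessThan_Suc)
qed (simp)

text \<open>Both sums differ from Cartan's convention by one sign depending on the degree alone, so
  identities for \<open>dCE\<close> carry over.\<close>

lemma ce_diff_eq_diff:
  assumes "f \<in> cochains scaleL scaleV n"
  shows "ce_diff scaleV br \<rho> n f = (\<lambda>xs. scaleV ((-1) ^ (n + 1)) (dCE f xs))"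
proof
  fix xs :: "'l list"
  have f: "supported n f" "multilinear scaleL scaleV f" "alternating f"
    using assms cochains_iff[OF vector_space_axioms V.vector_space_axioms] by auto
  show "ce_diff scaleV br \<rho> n f xs = scaleV ((-1) ^ (n + 1)) (dCE f xs)"
  proof (cases "length xs = n + 1")
    case True
    have "(-1::'k) ^ (i + j + n + 1) = (-1) ^ (n + 1) * (-1) ^ (i + j)"
        "(-1::'k) ^ (i + 1 + n) = (-1) ^ (n + 1) * (-1) ^ i" for i j
      by (simp_all add: power_add)
    then show ?thesis
      unfolding dCE_eq_sum[OF f(2,3)]
      by (simp add: ce_diff_def True V.scale_right_distrib V.scale_sum_right
          del: sum.lessThan_Suc power_Suc V.scale_minus_left)
  next
    case False
    then show ?thesis
      using dCE_supported[OF f(1)] by (simp add: ce_diff_def supported_def)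
  qed
qed

lemma ce_diff_cochains:
  assumes "f \<in> cochains scaleL scaleV n"
  shows "ce_diff scaleV br \<rho> n f \<in> cochains scaleL scaleV (n + 1)"
proof -
  have f: "supported n f" "multilinear scaleL scaleV f" "alternating f"
    using assms cochains_iff[OF vector_space_axioms V.vector_space_axioms] by auto
  have "multilinear scaleL scaleV (\<lambda>xs. scaleV ((-1) ^ (n + 1)) (dCE f xs))"
    by (rule multilinear_compose[OF dCE_multilinear[OF f(2)]])
      (auto simp: Vector_Spaces.linear_iff V.vector_space_axioms V.scale_right_distrib mult.commute)
  then show ?thesis
    unfolding ce_diff_eq_diff[OF assms]
    using dCE_supported[OF f(1)] dCE_alternating[OF f(2,3)]
    by (auto simp: cochains_iff[OF vector_space_axioms V.vector_space_axioms] supported_def alternating_def)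
qed

lemma ce_diff_squared:
  assumes "f \<in> cochains scaleL scaleV n"
  shows "ce_diff scaleV br \<rho> (n + 1) (ce_diff scaleV br \<rho> n f) = 0"
proof -
  have "multilinear scaleL scaleV f"
    using assms cochains_iff[OF vector_space_axioms V.vector_space_axioms] by auto
  then show ?thesis
    unfolding ce_diff_eq_diff[OF ce_diff_cochains[OF assms]] unfolding ce_diff_eq_diff[OF assms]
    by (simp only: dCE_scale dCE_squared V.scale_zero_right zero_fun_def)
qed

lemma ce_diff_add:
  "ce_diff scaleV br \<rho> n (f + g) = ce_diff scaleV br \<rho> n f + ce_diff scaleV br \<rho> n g"
  by (simp add: ce_diff_def fun_eq_iff action_add V.scale_right_distrib sum.distrib
      del: sum.lessThan_Suc power_Suc)

lemma ce_diff_scale: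
  "ce_diff scaleV br \<rho> n (scale_cochain scaleV c f) = scale_cochain scaleV c (ce_diff scaleV br \<rho> n f)"
  by (simp add: ce_diff_def scale_cochain_def fun_eq_iff action_scale V.scale_right_distrib
      V.scale_sum_right mult.commute del: sum.lessThan_Suc power_Suc)

end

section \<open>The Rota--Baxter twist\<close>

text \<open>
  For \<open>Q = R + \<lambda>\<close> this is the sum over proper subsets of positions in the definition of \<open>\<Phi>\<close>,
  regrouped by the first position at which \<open>R\<close> is not applied.
\<close>

fun mixed_sum ::
    "('l \<Rightarrow> 'l) \<Rightarrow> ('l \<Rightarrow> 'l) \<Rightarrow> ('l, 'v::ab_group_add) cochain \<Rightarrow> ('l, 'v) cochain" where
  "mixed_sum R Q f [] = 0"
| "mixed_sum R Q f (x # xs) = mixed_sum R Q (\<lambda>ys. f (R x # ys)) xs + f (x # map Q xs)"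

lemma mixed_sum_zero: "mixed_sum R Q (\<lambda>ys. 0) xs = 0"
  by (induction xs) simp_all

lemma mixed_sum_add:
  "mixed_sum R Q (\<lambda>ys. f ys + g ys) xs = mixed_sum R Q f xs + mixed_sum R Q g xs"
  by (induction xs arbitrary: f g) (simp_all add: algebra_simps)

lemma mixed_sum_diff:
  "mixed_sum R Q (\<lambda>ys. f ys - g ys) xs = mixed_sum R Q f xs - mixed_sum R Q g xs"
  by (induction xs arbitrary: f g) (simp_all add: algebra_simps)

lemma mixed_sum_compose:
  assumes "additive t"
  shows "mixed_sum R Q (\<lambda>ys. t (f ys)) xs = t (mixed_sum R Q f xs)"
  by (induction xs arbitrary: f) (simp_all add: additive.zero[OF assms] additive.add[OF assms])

lemma mixed_sum_supported: "supported n f \<Longrightarrow> supported n (mixed_sum R Q f)"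
  unfolding supported_def
proof (intro allI impI)
  fix xs :: "'a list"
  assume "\<forall>xs. length xs \<noteq> n \<longrightarrow> f xs = 0" "length xs \<noteq> n"
  then show "mixed_sum R Q f xs = 0"
  proof (induction xs arbitrary: f n)
    case (Cons x xs)
    show ?case
    proof (cases n)
      case 0
      then have "(\<lambda>ys. f (R x # ys)) = (\<lambda>ys. 0)"
        using Cons.prems by auto
      then show ?thesis using 0 Cons.prems(1) by (simp add: mixed_sum_zero)
    next
      case (Suc m)
      then show ?thesis
        using Cons.IH[of m "\<lambda>ys. f (R x # ys)"] Cons.prems by simp
    qed
  qed simp
qed

lemma mixed_sum_multilinear:
  assumes f: "multilinear s1 s2 f" and "vector_space s2"
    and R: "Vector_Spaces.linear s1 s1 R" and Q: "Vector_Spaces.linear s1 s1 Q"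
  shows "multilinear s1 s2 (mixed_sum R Q f)"
proof (rule multilinearI)
  interpret V: vector_space s2 by fact
  note R' = R[unfolded Vector_Spaces.linear_iff] and Q' = Q[unfolded Vector_Spaces.linear_iff]
  show "mixed_sum R Q f (us @ (x + y) # vs)
      = mixed_sum R Q f (us @ x # vs) + mixed_sum R Q f (us @ y # vs)" for us vs x y
    using f
  proof (induction us arbitrary: f)
    case Nil
    then show ?case
      by (simp add: R' multilinear_add_Cons mixed_sum_add)
  next
    case (Cons u us)
    then show ?case
      using multilinear_add[OF Cons.prems, of "u # map Q us" "Q x" "Q y" "map Q vs"]
      by (simp add: Q' Cons.IH[OF multilinear_partial])
  qed
  show "mixed_sum R Q f (us @ s1 c x # vs) = s2 c (mixed_sum R Q f (us @ x # vs))" for us vs c x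
    using f
  proof (induction us arbitrary: f)
    case Nil
    then show ?case
      by (simp add: R' multilinear_scale_Cons V.scale_right_distrib
          mixed_sum_compose[OF additive_scale[OF V.vector_space_axioms]])
  next
    case (Cons u us)
    then show ?case
      using multilinear_scale[OF Cons.prems, of "u # map Q us" c "Q x" "map Q vs"]
      by (simp add: Q' Cons.IH[OF multilinear_partial] V.scale_right_distrib)
  qed
qed

lemma mixed_sum_alternating:
  assumes "multilinear s1 s2 f" "alternating f" "vector_space s2"
    and Q: "\<And>x. Q x = R x + s1 c x"
  shows "alternating (mixed_sum R Q f)"
  unfolding alternating_def
proof (intro allI)
  interpret V: vector_space s2 by fact
  fix us a vs
  show "mixed_sum R Q f (us @ a # a # vs) = 0"
    using assms(1,2)
  proof (induction us arbitrary: f)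
    case Nil
    then have zero: "f (b # b # ys) = 0" for b ys
      using alternatingD[of f "[]"] by auto
    \<comment> \<open>As \<open>Q a\<close> is \<open>R a\<close> plus a multiple of
      \<open>a\<close>, the terms with the bare argument in the first and in the second of the equal
      slots cancel.\<close>
    have "f (a # Q a # map Q vs) = - f (R a # a # map Q vs)"
      using multilinear_add[OF Nil(1), of "[a]" "R a" "s1 c a" "map Q vs"]
        multilinear_scale[OF Nil(1), of "[a]" c a "map Q vs"]
        alternating_swap_Cons[OF Nil, of a "R a" "map Q vs"]
      by (simp add: Q zero)
    then show ?case
      by (simp add: zero mixed_sum_zero)
  next
    case (Cons u us)
    then show ?case
      using alternatingD[of f "u # map Q us"]
      by (simp add: Cons.IH[OF multilinear_partial alternating_partial])
  qed
qed

text \<open>The slots are switched from \<open>R\<close> to \<open>Q\<close> one at a time; each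
  switch costs \<open>c\<close> times the term with a bare argument in that slot.\<close>

lemma mixed_sum_telescope:
  assumes "multilinear s1 s2 f" "vector_space s2"
    and Q: "\<And>x. Q x = R x + s1 c x"
  shows "f (map Q xs) - f (map R xs) = s2 c (mixed_sum R Q f xs)"
proof -
  interpret V: vector_space s2 by fact
  show ?thesis
    using assms(1)
  proof (induction xs arbitrary: f)
    case (Cons x xs)
    have "f (Q x # map Q xs) = f (R x # map Q xs) + s2 c (f (x # map Q xs))"
      by (simp add: Q multilinear_add_Cons[OF Cons.prems] multilinear_scale_Cons[OF Cons.prems])
    then show ?case
      using Cons.IH[OF multilinear_partial[OF Cons.prems, of "R x"]]
      by (simp add: V.scale_right_distrib algebra_simps)
  qed simp
qed

text \<open>
  \<open>a\<close>, \<open>b\<close>, \<open>c\<close> stand for \<open>[x, -]\<^sub>R\<close>, \<open>[R x, -]\<close> and \<open>[x, -]\<close>; this is the bracket part of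
  the compatibility of \<open>\<Phi>\<close> with the Lie derivative.
\<close>

lemma slot_sum_mixed_sum:
  assumes "multilinear s1 s2 f" "vector_space s1" "vector_space s2"
    and Q: "\<And>x. Q x = R x + s1 l x"
    and R: "\<And>y. R (a y) = b (R y)"
    and a: "\<And>y. a y = b y + c (Q y)"
    and bl: "\<And>y. b (s1 l y) = s1 l (b y)" and ba: "\<And>y z. b (y + z) = b y + b z"
  shows "slot_sum a (mixed_sum R Q f) xs
    = mixed_sum R Q (slot_sum b f) xs + slot_sum c f (map Q xs)"
  using assms(1)
proof (induction xs arbitrary: f)
  case (Cons y ys)
  interpret L: vector_space s1 by fact
  interpret V: vector_space s2 by fact
  note mp = multilinear_partial[OF Cons.prems]
  \<comment> \<open>As [Q x, -] is \<open>b\<close> plus \<lambda> times \<open>c\<close>, this says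
    that \<open>Q\<close> takes the twisted bracket to the original one.\<close>
  have Qa: "Q (a z) = b (Q z) + s1 l (c (Q z))" for z
    by (simp only: Q[of "a z"] R) (simp add: Q a bl ba L.scale_right_distrib)
  have "slot_sum a (\<lambda>zs. f (y # map Q zs)) ys
      = slot_sum (\<lambda>z. b z + s1 l (c z)) (\<lambda>zs. f (y # zs)) (map Q ys)"
    by (rule slot_sum_map) (rule Qa)
  then have step: "slot_sum a (\<lambda>zs. f (y # map Q zs)) ys
      = slot_sum b (\<lambda>zs. f (y # zs)) (map Q ys) + s2 l (slot_sum c (\<lambda>zs. f (y # zs)) (map Q ys))"
    by (simp only: slot_sum_arg_add[OF mp] slot_sum_arg_scale[OF mp V.vector_space_axioms])
  \<comment> \<open>The goal has \<open>Q y\<close> in the first slot, the induction hypothesis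
    \<open>R y\<close>; the difference matches the extra term of \<open>step\<close>.\<close>
  have "(\<lambda>zs. f (Q y # zs)) = (\<lambda>zs. f (R y # zs) + s2 l (f (y # zs)))"
    by (simp add: Q multilinear_add_Cons[OF Cons.prems] multilinear_scale_Cons[OF Cons.prems])
  then have "slot_sum c (\<lambda>zs. f (Q y # zs)) (map Q ys) = slot_sum c (\<lambda>zs. f (R y # zs)) (map Q ys)
      + s2 l (slot_sum c (\<lambda>zs. f (y # zs)) (map Q ys))"
    by (simp only: slot_sum_add slot_sum_compose[OF additive_scale[OF V.vector_space_axioms]])
  moreover have "f (a y # map Q ys) = f (b y # map Q ys) + f (c (Q y) # map Q ys)"
    by (simp only: a multilinear_add_Cons[OF Cons.prems])
  ultimately show ?case
    by (simp add: slot_sum_add mixed_sum_add step Cons.IH[OF mp] R algebra_simps)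
qed simp

section \<open>Expansion over sets of positions\<close>

lemma sum_Pow_Suc:
  "(\<Sum>S\<in>Pow {..<Suc n}. G S)
     = (\<Sum>S\<in>Pow {..<n}. G (Suc ` S)) + (\<Sum>S\<in>Pow {..<n}. G (insert 0 (Suc ` S)))"
proof -
  have Pow_image: "Pow (Suc ` {..<n}) = (`) Suc ` Pow {..<n}"
    by (simp add: image_Pow_surj)
  have Pow_eq: "Pow {..<Suc n} = (`) Suc ` Pow {..<n} \<union> (\<lambda>S. insert 0 (Suc ` S)) ` Pow {..<n}"
    unfolding lessThan_Suc_eq_insert_0 Pow_insert Pow_image by (simp add: image_image)
  have inj: "inj_on ((`) Suc) A" "inj_on (\<lambda>S. insert 0 (Suc ` S)) A" for A
  proof -
    \<comment> \<open>Taking the preimage under \<open>Suc\<close> undoes both ways of extending a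
      set of positions.\<close>
    have "Suc -` insert 0 (Suc ` S) = S" "Suc -` (Suc ` S) = S" for S
      by auto
    then show "inj_on ((`) Suc) A" "inj_on (\<lambda>S. insert 0 (Suc ` S)) A"
      by (metis inj_on_inverseI)+
  qed
  show ?thesis
    unfolding Pow_eq
    by (subst sum.union_disjoint) (auto simp: sum.reindex inj o_def)
qed

lemma apply_at_Nil: "apply_at R S [] = []"
  by (simp add: apply_at_def)

lemma apply_at_Cons:
  "apply_at R (Suc ` S) (x # xs) = x # apply_at R S xs"
  "apply_at R (insert 0 (Suc ` S)) (x # xs) = R x # apply_at R S xs"
  unfolding apply_at_def list.size add_Suc_right add_0_right map_upt_Suc by auto

lemma card_Suc_image: "card (Suc ` S) = card S"
  by (simp add: card_image)

lemma card_insert_0_Suc_image: "finite S \<Longrightarrow> card (insert 0 (Suc ` S)) = Suc (card S)"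
  by (simp add: card_image)

text \<open>Binomial expansion of R + \<lambda> in every slot; each position outside
  \<open>S\<close> contributes one factor \<lambda>.\<close>

lemma map_eq_sum_apply_at:
  assumes "multilinear s1 s2 f" "vector_space s2" and Q: "\<And>x. Q x = R x + s1 l x"
  shows "f (map Q xs)
    = (\<Sum>S\<in>Pow {..<length xs}. s2 (l ^ (length xs - card S)) (f (apply_at R S xs)))"
proof -
  interpret V: vector_space s2 by fact
  show ?thesis
    using assms(1)
  proof (induction xs arbitrary: f)
    case Nil
    then show ?case by (simp add: apply_at_Nil)
  next
    case (Cons x xs)
    let ?n = "length xs"
    have "(\<Sum>S\<in>Pow {..<?n}. s2 (l ^ (Suc ?n - card S)) (f (x # apply_at R S xs)))
        = s2 l (f (x # map Q xs))"
      unfolding Cons.IH[OF multilinear_partial[OF Cons.prems]] V.scale_sum_right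
    proof (intro sum.cong refl)
      fix S
      assume "S \<in> Pow {..<?n}"
      then have "card S \<le> ?n"
        using card_mono[of "{..<?n}" S] by simp
      then show "s2 (l ^ (Suc ?n - card S)) (f (x # apply_at R S xs))
          = s2 l (s2 (l ^ (?n - card S)) (f (x # apply_at R S xs)))"
        by (simp add: Suc_diff_le)
    qed
    moreover have "(\<Sum>S\<in>Pow {..<?n}. s2 (l ^ (Suc ?n - card (insert 0 (Suc ` S)))) (f (R x # apply_at R S xs)))
        = f (R x # map Q xs)"
      unfolding Cons.IH[OF multilinear_partial[OF Cons.prems]]
      by (intro sum.cong) (auto simp: card_insert_0_Suc_image finite_subset simp del: card_insert_disjoint)
    ultimately show ?case
      unfolding list.size add_Suc_right add_0_right sum_Pow_Suc apply_at_Cons card_Suc_image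
      by (simp add: Q[of x] multilinear_add_Cons[OF Cons.prems] multilinear_scale_Cons[OF Cons.prems])
  qed
qed

text \<open>The first position outside \<open>S\<close> holds the bare argument and gives no factor,
  so the exponent drops by one. The condition removes the full set, where truncated subtraction
  would give the spurious coefficient 1.\<close>

lemma mixed_sum_eq_sum_apply_at:
  assumes "multilinear s1 s2 f" "vector_space s2" and Q: "\<And>x. Q x = R x + s1 l x"
  shows "mixed_sum R Q f xs = (\<Sum>S\<in>Pow {..<length xs}.
    if card S < length xs then s2 (l ^ (length xs - card S - 1)) (f (apply_at R S xs)) else 0)"
  using assms(1)
proof (induction xs arbitrary: f)
  case (Cons x xs)
  let ?n = "length xs"
  have "(\<Sum>S\<in>Pow {..<?n}. if card S < Suc ?n
        then s2 (l ^ (Suc ?n - card S - 1)) (f (x # apply_at R S xs)) else 0) = f (x # map Q xs)"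
    unfolding map_eq_sum_apply_at[OF multilinear_partial[OF Cons.prems] assms(2) Q]
  proof (intro sum.cong refl)
    fix S
    assume "S \<in> Pow {..<?n}"
    then have "card S \<le> ?n"
      using card_mono[of "{..<?n}" S] by simp
    then show "(if card S < Suc ?n then s2 (l ^ (Suc ?n - card S - 1)) (f (x # apply_at R S xs)) else 0)
        = s2 (l ^ (?n - card S)) (f (x # apply_at R S xs))"
      by simp
  qed
  moreover have "(\<Sum>S\<in>Pow {..<?n}. if card (insert 0 (Suc ` S)) < Suc ?n
        then s2 (l ^ (Suc ?n - card (insert 0 (Suc ` S)) - 1)) (f (R x # apply_at R S xs)) else 0)
      = mixed_sum R Q (\<lambda>ys. f (R x # ys)) xs"
    unfolding Cons.IH[OF multilinear_partial[OF Cons.prems]]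
    by (intro sum.cong) (auto simp: card_insert_0_Suc_image finite_subset simp del: card_insert_disjoint)
  ultimately show ?case
    unfolding list.size add_Suc_right add_0_right sum_Pow_Suc apply_at_Cons card_Suc_image
    by simp
qed simp
section \<open>Cochain maps of a Rota--Baxter LieDer pair\<close>

text \<open>Free of the length test in \<open>der_diff\<close>, so that it unfolds along the list;
  on cochains the two agree.\<close>

definition der_op ::
    "('l \<Rightarrow> 'l) \<Rightarrow> ('v \<Rightarrow> 'v) \<Rightarrow> ('l, 'v::ab_group_add) cochain \<Rightarrow> ('l, 'v) cochain" where
  "der_op \<delta> \<delta>V f xs = slot_sum \<delta> f xs - \<delta>V (f xs)"

context rota_baxter_lieder_representation
begin

sublocale lie_module scaleL scaleV br \<rho>
  by (intro lie_module.intro lie_module_axioms.intro lie_algebra_axioms V.vector_space_axioms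
      rho_endomorphism rho_linear rho_bracket)

abbreviation brR where "brR \<equiv> bracket_R scaleL br lam R"
abbreviation rhoR where "rhoR \<equiv> rho_tilde R \<rho> T"

section \<open>The twisted Lie algebra and its module\<close>

lemma R_add: "R (x + y) = R x + R y"
  and R_scale: "R (scaleL c x) = scaleL c (R x)"
  using R_linear by (simp_all add: Vector_Spaces.linear_iff)

lemma T_additive: "additive T"
  by (rule linear_imp_additive[OF T_linear])

lemmas T_add = additive.add[OF T_additive]
  and T_diff = additive.diff[OF T_additive]
  and T_zero = additive.zero[OF T_additive]

lemma T_scale: "T (scaleV c u) = scaleV c (T u)"
  using T_linear by (simp add: Vector_Spaces.linear_iff)

lemma derV_additive: "additive \<delta>V"
  by (rule linear_imp_additive[OF derV_linear])

lemma R_brR: "R (brR x y) = br (R x) (R y)"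
  by (simp add: bracket_R_def R_rota_baxter)

text \<open>\<open>R_brR\<close> removes \<open>R\<close> from the inner brackets; the sum then
  splits into seven Jacobi sums of \<open>br\<close>, with \<open>R\<close> on two, one or none of
  the arguments.\<close>

lemma brR_jacobi: "brR x (brR y z) + brR y (brR z x) + brR z (brR x y) = 0"
proof -
  let ?J = "\<lambda>x y z. br x (br y z) + br y (br z x) + br z (br x y)"
  have "brR x (brR y z) + brR y (brR z x) + brR z (brR x y)
      = ?J (R x) (R y) z + ?J (R x) y (R z) + ?J x (R y) (R z)
        + scaleL lam (?J (R x) y z + ?J x (R y) z + ?J x y (R z))
        + scaleL lam (scaleL lam (?J x y z))"
    unfolding bracket_R_def[of scaleL br lam R x "brR y z"] bracket_R_def[of scaleL br lam R y "brR z x"]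
      bracket_R_def[of scaleL br lam R z "brR x y"] R_brR
    by (simp add: bracket_R_def br_add_right br_scale_right scale_right_distrib ac_simps)
  then show ?thesis
    by (simp only: br_jacobi scale_zero_right add_0_right)
qed

sublocale twisted: lie_module scaleL scaleV brR rhoR
proof (intro lie_module.intro lie_module_axioms.intro lie_algebra.intro lie_algebra_axioms.intro
    vector_space_axioms V.vector_space_axioms)
  show "Vector_Spaces.linear scaleL scaleL (brR x)" for x
    by (simp add: Vector_Spaces.linear_iff bracket_R_def br_add_right br_scale_right R_add R_scale
        scale_right_distrib vector_space_axioms algebra_simps)
  show "Vector_Spaces.linear scaleL scaleL (\<lambda>x. brR x y)" for y
    by (simp add: Vector_Spaces.linear_iff bracket_R_def br_add_left br_scale_left R_add R_scale
        scale_right_distrib vector_space_axioms algebra_simps)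
  show "brR x x = 0" for x
    using br_skew[of x "R x"] by (simp add: bracket_R_def br_alternating)
  show "brR x (brR y z) + brR y (brR z x) + brR z (brR x y) = 0" for x y z
    by (rule brR_jacobi)
  show "Vector_Spaces.linear scaleV scaleV (rhoR x)" for x
    by (simp add: Vector_Spaces.linear_iff rho_tilde_def action_add action_scale T_add T_scale
        V.scale_right_diff_distrib V.vector_space_axioms)
  show "Vector_Spaces.linear scaleL scaleV (\<lambda>x. rhoR x u)" for u
    by (simp add: Vector_Spaces.linear_iff rho_tilde_def action_arg_add action_arg_scale T_add T_scale
        R_add R_scale V.scale_right_diff_distrib V.vector_space_axioms vector_space_axioms)
  show "rhoR (brR x y) u = rhoR x (rhoR y u) - rhoR y (rhoR x u)" for x y u
  proof -
    \<comment> \<open>In a double twisted action \<open>T_rota_baxter\<close> expands the action of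
      \<open>R x\<close> on \<open>T (\<rho> y u)\<close>. The summand with a nested
      \<open>T\<close> cancels, and antisymmetrising the rest gives these six terms.\<close>
    have "T (\<rho> (brR x y) u) = T (\<rho> (R x) (\<rho> y u)) - T (\<rho> y (\<rho> (R x) u))
        + T (\<rho> x (\<rho> (R y) u)) - T (\<rho> (R y) (\<rho> x u))
        + T (scaleV lam (\<rho> x (\<rho> y u))) - T (scaleV lam (\<rho> y (\<rho> x u)))"
      by (simp add: bracket_R_def action_arg_add action_arg_scale rho_bracket T_add T_diff
          V.scale_right_diff_distrib)
    then show ?thesis
      by (simp add: rho_tilde_def R_brR rho_bracket action_diff T_rota_baxter T_add T_diff algebra_simps)
  qed
qed

section \<open>The twist as a cochain map\<close>

abbreviation Q where "Q x \<equiv> R x + scaleL lam x"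

definition phi :: "('l, 'v) cochain \<Rightarrow> ('l, 'v) cochain" where
  "phi f xs = f (map R xs) - T (mixed_sum R Q f xs)"

lemma Q_brR: "Q (brR x y) = br (Q x) (Q y)"
  by (simp only: R_brR)
    (simp add: bracket_R_def br_add_left br_add_right br_scale_left br_scale_right scale_right_distrib
      algebra_simps)

text \<open>The twist in \<open>rho_tilde\<close> cancels the nested \<open>T\<close> of the
  Rota-Baxter identity, which makes \<open>T\<close> a module map from the action through
  \<open>Q\<close> to the twisted one.\<close>

lemma rhoR_T: "rhoR x (T u) = T (\<rho> (Q x) u)"
  by (simp add: rho_tilde_def T_rota_baxter action_arg_add action_arg_scale T_add)

lemma lie_phi:
  assumes "multilinear scaleL scaleV f"
  shows "twisted.lie x (phi f) xs = phi (lie (R x) f) xs - T (lie x f (map Q xs))"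
proof -
  have S: "slot_sum (brR x) (mixed_sum R Q f) xs
      = mixed_sum R Q (slot_sum (br (R x)) f) xs + slot_sum (br x) f (map Q xs)"
    using assms vector_space_axioms V.vector_space_axioms
    by (rule slot_sum_mixed_sum[where l=lam])
      (simp_all add: bracket_R_def br_add_right br_scale_right R_rota_baxter)
  have SR: "slot_sum (brR x) (\<lambda>ys. f (map R ys)) xs = slot_sum (br (R x)) f (map R xs)"
    by (rule slot_sum_map) (rule R_brR)
  have tel: "f (map Q xs) - f (map R xs) = scaleV lam (mixed_sum R Q f xs)"
    using assms V.vector_space_axioms by (rule mixed_sum_telescope) simp
  \<comment> \<open>Telescoping absorbs the \<lambda>-term of \<open>rhoR_T\<close> into
    \<open>f\<close> at the \<open>R\<close>-arguments, so the correction is evaluated at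
    \<open>Q\<close>.\<close>
  have "\<rho> x (f (map Q xs)) = \<rho> x (f (map R xs)) + scaleV lam (\<rho> x (mixed_sum R Q f xs))"
    unfolding action_scale[symmetric] tel[symmetric] by (simp add: action_diff)
  then have "rhoR x (phi f xs) = \<rho> (R x) (f (map R xs)) - T (\<rho> x (f (map Q xs)))
      - T (\<rho> (R x) (mixed_sum R Q f xs))"
    unfolding phi_def twisted.action_diff rhoR_T
    by (simp add: rho_tilde_def T_add action_arg_add action_arg_scale)
  moreover have "slot_sum (brR x) (phi f) xs
      = slot_sum (br (R x)) f (map R xs) - T (slot_sum (brR x) (mixed_sum R Q f) xs)"
    unfolding phi_def[abs_def] by (simp only: slot_sum_diff slot_sum_compose[OF T_additive] SR)
  moreover have "mixed_sum R Q (lie (R x) f) xs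
      = \<rho> (R x) (mixed_sum R Q f xs) - mixed_sum R Q (slot_sum (br (R x)) f) xs"
    unfolding lie_deriv_def[abs_def]
    by (simp only: mixed_sum_diff mixed_sum_compose[OF action_additive])
  ultimately show ?thesis
    by (simp only: lie_deriv_def[of brR] phi_def[of "lie (R x) f"] S)
      (simp add: lie_deriv_def T_add T_diff)
qed

text \<open>Inserting \<open>x\<close> into \<open>phi f\<close> leaves a correction with
  \<open>T\<close> and \<open>Q\<close>, which d respects by \<open>cartan_natural\<close>. Together
  with the correction in \<open>lie_phi\<close> it is exactly the one belonging to
  \<open>dCE f\<close>.\<close>

lemma dCE_phi:
  assumes "multilinear scaleL scaleV f"
  shows "twisted.dCE (phi f) xs = phi (dCE f) xs"
  using assms
proof (induction xs arbitrary: f)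
  case Nil
  then show ?case by (simp add: phi_def T_zero)
next
  case (Cons x xs)
  have "twisted.dCE (\<lambda>ys. phi f (x # ys)) xs
      = twisted.dCE (\<lambda>ys. phi (\<lambda>zs. f (R x # zs)) ys - T (f (x # map Q ys))) xs"
    by (simp add: phi_def T_add algebra_simps)
  also have "\<dots> = phi (dCE (\<lambda>zs. f (R x # zs))) xs - T (dCE (\<lambda>zs. f (x # zs)) (map Q xs))"
    using cartan_natural[where t=T and h=Q and br'=brR and br=br and \<rho>'=rhoR and \<rho>=\<rho> and f="\<lambda>zs. f (x # zs)", OF T_additive Q_brR rhoR_T]
    by (simp only: twisted.dCE_diff Cons.IH[OF multilinear_partial[OF Cons.prems]])
  finally show ?case
    unfolding cartan.simps lie_phi[OF Cons.prems]
    by (simp add: phi_def mixed_sum_diff T_add T_diff algebra_simps)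
qed

lemma phi_multilinear:
  assumes "multilinear scaleL scaleV f"
  shows "multilinear scaleL scaleV (phi f)"
proof -
  have "Vector_Spaces.linear scaleL scaleL Q"
    by (simp add: Vector_Spaces.linear_iff R_add R_scale scale_right_distrib vector_space_axioms
        mult.commute)
  from mixed_sum_multilinear[OF assms V.vector_space_axioms R_linear this] show ?thesis
    unfolding phi_def[abs_def]
    by (intro multilinear_diff[OF V.vector_space_axioms] multilinear_map[OF assms R_linear]
        multilinear_compose[OF _ T_linear])
qed

lemma phi_alternating:
  assumes "multilinear scaleL scaleV f" "alternating f"
  shows "alternating (phi f)"
  using mixed_sum_alternating[OF assms V.vector_space_axioms, of Q R lam] assms(2)
  by (simp add: alternating_def phi_def T_zero)

lemma phi_supported: "supported n f \<Longrightarrow> supported n (phi f)"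
  using mixed_sum_supported[of n f R Q] by (simp add: supported_def phi_def T_zero)

lemma phi_scale: "phi (\<lambda>ys. scaleV c (f ys)) xs = scaleV c (phi f xs)"
  by (simp add: phi_def mixed_sum_compose[OF additive_scale[OF V.vector_space_axioms]] T_scale
      V.scale_right_diff_distrib)

lemma cochainsD:
  assumes "f \<in> cochains scaleL scaleV n"
  shows "supported n f" "multilinear scaleL scaleV f" "alternating f"
  using assms cochains_iff[OF vector_space_axioms V.vector_space_axioms] by auto

lemma cochainsI:
  "supported n f \<Longrightarrow> multilinear scaleL scaleV f \<Longrightarrow> alternating f \<Longrightarrow> f \<in> cochains scaleL scaleV n"
  using cochains_iff[OF vector_space_axioms V.vector_space_axioms] by auto

lemma Phi_eq_phi:
  assumes "f \<in> cochains scaleL scaleV n"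
  shows "Phi scaleV lam R T n f = phi f"
proof
  note f = cochainsD[OF assms]
  fix xs :: "'l list"
  show "Phi scaleV lam R T n f xs = phi f xs"
  proof (cases "length xs = n")
    case True
    let ?G = "\<lambda>S. if card S < n then scaleV (lam ^ (n - card S - 1)) (f (apply_at R S xs)) else 0"
    have "card ` Pow {..<n} \<subseteq> {..n}"
      using card_mono[of "{..<n}"] by fastforce
    \<comment> \<open>The subsets are grouped by size; the class of size \<open>n\<close> is zero
      because of the condition in \<open>?G\<close>.\<close>
    then have "sum ?G (Pow {..<n}) = (\<Sum>k\<le>n. sum ?G {S \<in> Pow {..<n}. card S = k})"
      by (intro sum.group[symmetric]) auto
    also have "\<dots> = (\<Sum>k<n. sum ?G {S \<in> Pow {..<n}. card S = k})"
      unfolding lessThan_Suc_atMost[symmetric] sum.lessThan_Suc by simp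
    also have "\<dots> = (\<Sum>k<n. scaleV (lam ^ (n - k - 1)) (\<Sum>S | S \<subseteq> {..<n} \<and> card S = k. f (apply_at R S xs)))"
      by (simp add: V.scale_sum_right)
    finally have "mixed_sum R Q f xs
        = (\<Sum>k<n. scaleV (lam ^ (n - k - 1)) (\<Sum>S | S \<subseteq> {..<n} \<and> card S = k. f (apply_at R S xs)))"
      using mixed_sum_eq_sum_apply_at[OF f(2) V.vector_space_axioms, of Q R lam xs]
      unfolding True by simp
    then show ?thesis
      using True by (simp add: Phi_def phi_def additive.sum[OF T_additive] T_scale)
  next
    case False
    then show ?thesis
      using phi_supported[OF f(1)] by (simp add: Phi_def supported_def)
  qed
qed

lemma Phi_cochains:
  assumes "f \<in> cochains scaleL scaleV n"
  shows "Phi scaleV lam R T n f \<in> cochains scaleL scaleV n"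
  unfolding Phi_eq_phi[OF assms]
  using cochainsD[OF assms]
  by (intro cochainsI phi_supported phi_multilinear phi_alternating)

theorem ce_diff_Phi:
  assumes "f \<in> cochains scaleL scaleV n"
  shows "ce_diff scaleV brR rhoR n (Phi scaleV lam R T n f)
    = Phi scaleV lam R T (n + 1) (ce_diff scaleV br \<rho> n f)"
  unfolding twisted.ce_diff_eq_diff[OF Phi_cochains[OF assms]]
    Phi_eq_phi[OF ce_diff_cochains[OF assms]]
  unfolding ce_diff_eq_diff[OF assms] Phi_eq_phi[OF assms]
  by (rule ext) (simp only: dCE_phi[OF cochainsD(2)[OF assms]] phi_scale)

lemma Phi_add: "Phi scaleV lam R T n (f + g) = Phi scaleV lam R T n f + Phi scaleV lam R T n g"
  by (simp add: Phi_def fun_eq_iff T_add sum.distrib V.scale_right_distrib)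

lemma Phi_scale:
  "Phi scaleV lam R T n (scale_cochain scaleV c f) = scale_cochain scaleV c (Phi scaleV lam R T n f)"
  by (simp add: Phi_def scale_cochain_def fun_eq_iff T_scale V.scale_right_diff_distrib
      V.scale_sum_right mult.commute)

section \<open>Compatibility with the derivation\<close>

lemma der_op_lie:
  assumes "multilinear scaleL scaleV f"
  shows "der_op \<delta> \<delta>V (lie x f) xs = lie x (der_op \<delta> \<delta>V f) xs - lie (\<delta> x) f xs"
proof -
  have "slot_sum \<delta> (slot_sum (br x) f) xs - slot_sum (br x) (slot_sum \<delta> f) xs
      = slot_sum (\<lambda>y. br x (\<delta> y) - \<delta> (br x y)) f xs"
    unfolding slot_sum_commutator slot_sum_arg_diff[OF assms] ..
  \<comment> \<open>The explicit zero lets \<open>slot_sum_arg_diff\<close> extract the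
    sign.\<close>
  also have "(\<lambda>y. br x (\<delta> y) - \<delta> (br x y)) = (\<lambda>y. 0 - br (\<delta> x) y)"
    by (simp add: der_leibniz)
  also have "slot_sum \<dots> f xs = - slot_sum (br (\<delta> x)) f xs"
    using slot_sum_arg_diff[OF assms, of "br (\<delta> x)" "br (\<delta> x)" xs]
      slot_sum_arg_diff[OF assms, of "\<lambda>y. 0" "br (\<delta> x)" xs]
      slot_sum_arg_diff[OF assms, of "\<lambda>y. 0" "\<lambda>y. 0" xs] by simp
  finally show ?thesis
    by (simp add: der_op_def[abs_def] lie_deriv_def[abs_def] slot_sum_diff
        slot_sum_compose[OF action_additive] slot_sum_compose[OF derV_additive]
        action_diff additive.diff[OF derV_additive] derV_rho algebra_simps)
qed

lemma der_op_scale: "der_op \<delta> \<delta>V (\<lambda>ys. scaleV c (f ys)) xs = scaleV c (der_op \<delta> \<delta>V f xs)"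
  using derV_linear
  by (simp add: der_op_def slot_sum_compose[OF additive_scale[OF V.vector_space_axioms]]
      Vector_Spaces.linear_iff V.scale_right_diff_distrib)

lemma der_op_diff: "der_op \<delta> \<delta>V (\<lambda>ys. f ys - g ys) xs = der_op \<delta> \<delta>V f xs - der_op \<delta> \<delta>V g xs"
  by (simp add: der_op_def slot_sum_diff additive.diff[OF derV_additive])

lemma der_op_Cons:
  "der_op \<delta> \<delta>V f (x # xs) = der_op \<delta> \<delta>V (\<lambda>ys. f (x # ys)) xs + f (\<delta> x # xs)"
  by (simp add: der_op_def)

text \<open>Inserting \<open>x\<close> after \<open>der_op\<close> also inserts
  \<open>\<delta> x\<close>. The term \<open>lie (\<delta> x) f\<close> of \<open>der_op_lie\<close>
  supplies the Lie derivative in Cartan's formula for that second insertion.\<close>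

lemma dCE_der_op:
  assumes "multilinear scaleL scaleV f"
  shows "dCE (der_op \<delta> \<delta>V f) xs = der_op \<delta> \<delta>V (dCE f) xs"
  using assms
proof (induction xs arbitrary: f)
  case Nil
  then show ?case by (simp add: der_op_def additive.zero[OF derV_additive])
next
  case (Cons x xs)
  then show ?case
    using Cons.IH[OF multilinear_partial[OF Cons.prems, of x]] der_op_lie[OF Cons.prems, of x xs]
    by (simp add: der_op_Cons der_op_diff dCE_add algebra_simps)
qed

lemma der_diff_eq_der_op:
  assumes "f \<in> cochains scaleL scaleV n"
  shows "der_diff \<delta> \<delta>V n f = der_op \<delta> \<delta>V f"
  using cochainsD(1)[OF assms] slot_sum_supported[OF cochainsD(1)[OF assms], of \<delta>]
  by (auto simp: fun_eq_iff der_diff_def der_op_def slot_sum_eq_sum supported_def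
      additive.zero[OF derV_additive])

lemma der_diff_cochains:
  assumes "f \<in> cochains scaleL scaleV n"
  shows "der_diff \<delta> \<delta>V n f \<in> cochains scaleL scaleV n"
  unfolding der_diff_eq_der_op[OF assms]
proof (rule cochainsI)
  note f = cochainsD[OF assms]
  show "supported n (der_op \<delta> \<delta>V f)"
    using f(1) slot_sum_supported[OF f(1), of \<delta>]
    by (simp add: supported_def der_op_def additive.zero[OF derV_additive])
  show "multilinear scaleL scaleV (der_op \<delta> \<delta>V f)"
    unfolding der_op_def[abs_def]
    by (rule multilinear_diff[OF V.vector_space_axioms
          slot_sum_multilinear[OF f(2) V.vector_space_axioms der_linear]
          multilinear_compose[OF f(2) derV_linear]])
  show "alternating (der_op \<delta> \<delta>V f)"
    using f(3) slot_sum_alternating[OF f(2,3), of \<delta>]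
    by (simp add: alternating_def der_op_def additive.zero[OF derV_additive])
qed

theorem ce_diff_der_diff:
  assumes "f \<in> cochains scaleL scaleV n"
  shows "ce_diff scaleV br \<rho> n (der_diff \<delta> \<delta>V n f) = der_diff \<delta> \<delta>V (n + 1) (ce_diff scaleV br \<rho> n f)"
  unfolding ce_diff_eq_diff[OF der_diff_cochains[OF assms]]
    der_diff_eq_der_op[OF ce_diff_cochains[OF assms]]
  unfolding ce_diff_eq_diff[OF assms] der_diff_eq_der_op[OF assms]
  by (rule ext) (simp only: dCE_der_op[OF cochainsD(2)[OF assms]] der_op_scale)

lemma der_diff_add: "der_diff \<delta> \<delta>V n (f + g) = der_diff \<delta> \<delta>V n f + der_diff \<delta> \<delta>V n g"
  by (simp add: der_diff_def fun_eq_iff additive.add[OF derV_additive] sum.distrib)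

lemma der_diff_scale:
  "der_diff \<delta> \<delta>V n (scale_cochain scaleV c f) = scale_cochain scaleV c (der_diff \<delta> \<delta>V n f)"
  using derV_linear
  by (simp add: der_diff_def scale_cochain_def fun_eq_iff V.scale_right_diff_distrib
      V.scale_sum_right Vector_Spaces.linear_iff)

end
section \<open>The coboundary operator\<close>

context rota_baxter_lieder_representation
begin

lemma cochains_scale:
  assumes "f \<in> cochains scaleL scaleV n"
  shows "scale_cochain scaleV c f \<in> cochains scaleL scaleV n"
proof (rule cochainsI)
  note f = cochainsD[OF assms]
  have "Vector_Spaces.linear scaleV scaleV (scaleV c)"
    by (simp add: Vector_Spaces.linear_iff V.vector_space_axioms V.scale_right_distrib mult.commute)
  from multilinear_compose[OF f(2) this] show "multilinear scaleL scaleV (scale_cochain scaleV c f)"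
    by (simp add: scale_cochain_def)
  show "supported n (scale_cochain scaleV c f)" "alternating (scale_cochain scaleV c f)"
    using f by (simp_all add: supported_def alternating_def scale_cochain_def)
qed

lemma cochains_add:
  assumes "f \<in> cochains scaleL scaleV n" "g \<in> cochains scaleL scaleV n"
  shows "f + g \<in> cochains scaleL scaleV n"
proof (rule cochainsI)
  note f = cochainsD[OF assms(1)] and g = cochainsD[OF assms(2)]
  from multilinear_plus[OF V.vector_space_axioms f(2) g(2)] show "multilinear scaleL scaleV (f + g)"
    by (simp add: plus_fun_def)
  show "supported n (f + g)" "alternating (f + g)"
    using f g by (simp_all add: supported_def alternating_def)
qed

lemma uminus_eq_scale_cochain: "- f = scale_cochain scaleV (-1) f"
  by (simp add: scale_cochain_def fun_eq_iff)

lemma cochains_uminus: "f \<in> cochains scaleL scaleV n \<Longrightarrow> - f \<in> cochains scaleL scaleV n"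
  by (simp add: uminus_eq_scale_cochain cochains_scale)

lemma cochains_diff:
  "f \<in> cochains scaleL scaleV n \<Longrightarrow> g \<in> cochains scaleL scaleV n
    \<Longrightarrow> f - g \<in> cochains scaleL scaleV n"
  using cochains_add[of f n "- g"] by (simp add: cochains_uminus)

lemma scale_cochain_add:
  "scale_cochain scaleV c (f + g) = scale_cochain scaleV c f + scale_cochain scaleV c g"
  by (simp add: scale_cochain_def fun_eq_iff V.scale_right_distrib)

lemma scale_cochain_uminus: "scale_cochain scaleV c (- f) = - scale_cochain scaleV c f"
  by (simp add: scale_cochain_def fun_eq_iff)

lemma scale_cochain_diff:
  "scale_cochain scaleV c (f - g) = scale_cochain scaleV c f - scale_cochain scaleV c g"
  by (simp add: scale_cochain_def fun_eq_iff V.scale_right_diff_distrib)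

lemma scale_cochain_commute:
  "scale_cochain scaleV a (scale_cochain scaleV b f) = scale_cochain scaleV b (scale_cochain scaleV a f)"
  by (simp add: scale_cochain_def mult.commute)

abbreviation C where "C \<equiv> rb_cochains scaleL scaleV"
abbreviation D where "D \<equiv> rb_diff scaleL scaleV br lam \<delta> R \<rho> \<delta>V T"

lemma rb_diff_cochains:
  assumes "n \<ge> 1" "c \<in> C n"
  shows "D n c \<in> C (n + 1)"
proof -
  obtain f g h where c: "c = ((f, g), h)" by (metis surj_pair)
  have f: "f \<in> cochains scaleL scaleV n"
    using assms by (auto simp: rb_cochains_def c split: if_splits)
  note ops = cochains_uminus cochains_add cochains_diff cochains_scale ce_diff_cochains[OF f]
    der_diff_cochains[OF f] Phi_cochains[OF f]
  show ?thesis
  proof (cases "n = 1")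
    case True
    then show ?thesis
      using ops by (simp add: c rb_cochains_def)
  next
    case False
    then have gh: "g \<in> cochains scaleL scaleV (n - 1)" "h \<in> cochains scaleL scaleV (n - 1)"
      using assms by (auto simp: rb_cochains_def c)
    show ?thesis
      using ops ce_diff_cochains[OF gh(1)] twisted.ce_diff_cochains[OF gh(2)] assms(1) False
      by (simp add: c rb_cochains_def Let_def)
  qed
qed

lemma rb_diff_add: "D n (c + c') = D n c + D n c'"
proof -
  obtain f g h f' g' h' where c: "c = ((f, g), h)" "c' = ((f', g'), h')" by (metis surj_pair)
  show ?thesis
    by (simp add: c Let_def ce_diff_add twisted.ce_diff_add der_diff_add Phi_add scale_cochain_add)
qed

lemma rb_diff_scale: "D n (scale_rb_cochain scaleV a c) = scale_rb_cochain scaleV a (D n c)"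
proof -
  obtain f g h where c: "c = ((f, g), h)" by (metis surj_pair)
  show ?thesis
    by (simp add: c Let_def ce_diff_scale twisted.ce_diff_scale der_diff_scale Phi_scale
        scale_cochain_add scale_cochain_uminus scale_cochain_diff
        scale_cochain_commute[of "(-1) ^ n" a])
qed

text \<open>The components reduce to d d = 0, to d d = 0 with d \<partial> = \<partial> d, and to
  the same for d_R with \<open>ce_diff_Phi\<close>; the signs make the mixed terms cancel.\<close>

theorem rb_diff_squared:
  assumes "n \<ge> 1" "c \<in> C n"
  shows "D (n + 1) (D n c) = 0"
proof -
  obtain f g h where c: "c = ((f, g), h)" by (metis surj_pair)
  have f: "f \<in> cochains scaleL scaleV n"
    using assms by (auto simp: rb_cochains_def c split: if_splits)
  note f_rules = ce_diff_squared[OF f] ce_diff_der_diff[OF f, symmetric] ce_diff_Phi[OF f, symmetric]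
  have neg: "ce_diff scaleV br \<rho> k (- u) = - ce_diff scaleV br \<rho> k u"
    "ce_diff scaleV brR rhoR k (- u) = - ce_diff scaleV brR rhoR k u" for k u
    unfolding uminus_eq_scale_cochain by (rule ce_diff_scale twisted.ce_diff_scale)+
  show ?thesis
  proof (cases "n = 1")
    case True
    \<comment> \<open>The second application has degree 2, hence sign +1, against the minus of
      degree 1.\<close>
    have "scale_cochain scaleV ((-1) ^ 2) u = u" for u
      by (simp add: scale_cochain_def)
    then show ?thesis
      using f_rules True by (simp add: c Let_def neg zero_prod_def numeral_2_eq_2)
  next
    case False
    then have gh: "g \<in> cochains scaleL scaleV (n - 1)" "h \<in> cochains scaleL scaleV (n - 1)"
      using assms by (auto simp: rb_cochains_def c)
    \<comment> \<open>\<open>g\<close> and \<open>h\<close> have degree \<open>n - 1\<close>, so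
      their second differential is taken in degree \<open>n\<close>.\<close>
    have n: "n - 1 + 1 = n" using assms(1) by simp
    have "scale_cochain scaleV ((-1) ^ n) u + scale_cochain scaleV ((-1) ^ (n + 1)) u = 0" for u
      by (simp add: scale_cochain_def fun_eq_iff)
    moreover have "ce_diff scaleV brR rhoR n (- u - v)
        = - ce_diff scaleV brR rhoR n u - ce_diff scaleV brR rhoR n v" for u v
      using twisted.ce_diff_add[of n "- u" "- v"] by (simp add: neg)
    ultimately show ?thesis
      using f_rules ce_diff_squared[OF gh(1), unfolded n] twisted.ce_diff_squared[OF gh(2), unfolded n]
        False assms(1)
      by (simp add: c Let_def zero_prod_def ce_diff_add ce_diff_scale del: power_Suc)
  qed
qed

end

text \<open>All degrees share one type, so that the operator respects the cochain spaces has to be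
  claimed explicitly.\<close>

theorem theorem3p1:
  fixes scaleL :: "'k::field \<Rightarrow> 'l::ab_group_add \<Rightarrow> 'l"
    and scaleV :: "'k \<Rightarrow> 'v::ab_group_add \<Rightarrow> 'v"
    and br :: "'l \<Rightarrow> 'l \<Rightarrow> 'l"
    and lam :: 'k
    and \<delta> R :: "'l \<Rightarrow> 'l"
    and \<rho> :: "'l \<Rightarrow> 'v \<Rightarrow> 'v"
    and \<delta>V T :: "'v \<Rightarrow> 'v"
    and n :: nat
  defines "C \<equiv> rb_cochains scaleL scaleV"
    and "D \<equiv> rb_diff scaleL scaleV br lam \<delta> R \<rho> \<delta>V T"
  assumes "rota_baxter_lieder_pair scaleL br lam \<delta> R"
    and "rota_baxter_lieder_representation scaleL scaleV br lam \<delta> R \<rho> \<delta>V T"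
    and "n \<ge> 1"
  shows "D n ` C n \<subseteq> C (n + 1) \<and>
    (\<forall>c\<in>C n. \<forall>c'\<in>C n. D n (c + c') = D n c + D n c') \<and>
    (\<forall>a. \<forall>c\<in>C n. D n (scale_rb_cochain scaleV a c) = scale_rb_cochain scaleV a (D n c)) \<and>
    (\<forall>c\<in>C n. D (n + 1) (D n c) = 0)"
proof -
  interpret rep: rota_baxter_lieder_representation scaleL scaleV br lam \<delta> R \<rho> \<delta>V T by fact
  show ?thesis
    unfolding C_def D_def
    using rep.rb_diff_cochains[OF assms(5)] rep.rb_diff_squared[OF assms(5)]
      rep.rb_diff_add rep.rb_diff_scale
    by blast
qed

end
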